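(* Directed Nonblocker has a kernel with at most $3k-1$ vertices: there is a polynomial-time algorithm that, given a digraph $G$ and integer $k$, outputs an equivalent instance $(G',k')$ with $k'$ bounded by a function of $k$ and $G'$ having at most $3k-1$ vertices.
   Context: In a directed graph $G=(V,A)$, a dominating set is a set $V'\subseteq V$ such that for every $u\in V\setminus V'$ there is $v\in V'$ with an arc $vu\in A$. Directed Nonblocker: given a digraph $G$ on $n$ vertices and an integer $k$ (the parameter), decide whether $G$ has a dominating set with at most $n-k$ vertices.
   Formalization: The bound of 3k-1 vertices is stated for k ≥ 1 only, since for k ≤ 0 the number 3k-1 is negative and no digraph can satisfy it; equivalence, the bound on k' and polynomial running time hold for every integer k. *)

theory Defs
  imports
    "Graph_Theory.Pair_Digraph"
    "HOL-Computational_Algebra.Polynomial"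
begin

section \<open>Directed Nonblocker\<close>

definition dominating_set :: "'a pair_pre_digraph \<Rightarrow> 'a set \<Rightarrow> bool" where
  "dominating_set G S \<longleftrightarrow>
     S \<subseteq> pverts G \<and> (\<forall>u \<in> pverts G - S. \<exists>v \<in> S. (v, u) \<in> parcs G)"

text \<open>The bound is taken in the integers: there is no solution if \<open>k\<close> exceeds the order of \<open>G\<close>.\<close>

definition directed_nonblocker :: "'a pair_pre_digraph \<Rightarrow> int \<Rightarrow> bool" where
  "directed_nonblocker G k \<longleftrightarrow>
     (\<exists>S. dominating_set G S \<and> int (card S) \<le> int (card (pverts G)) - k)"

text \<open>
  Inputs and outputs of algorithms are finite simple digraphs (no loops, no parallel arcs) whose
  vertices are numbered \<open>0, \<dots>, n - 1\<close>, so that they can be written down as adjacency matrices.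
\<close>

definition numbered_digraph :: "nat pair_pre_digraph \<Rightarrow> bool" where
  "numbered_digraph G \<longleftrightarrow> pair_digraph G \<and> (\<exists>n. pverts G = {0..<n})"


section \<open>Encoding of instances as bit strings\<close>

text \<open>Binary representation, least significant bit first, without leading zeros.\<close>

fun nat_bits :: "nat \<Rightarrow> bool list" where
  "nat_bits n = (if n = 0 then [] else odd n # nat_bits (n div 2))"

declare nat_bits.simps [simp del]

definition int_bits :: "int \<Rightarrow> bool list" where
  "int_bits k = (k < 0) # nat_bits (nat \<bar>k\<bar>)"

text \<open>
  The order \<open>n\<close> in unary, closed by a zero, then the \<open>n * n\<close> entries of the adjacency matrix, row by
  row. This is self-delimiting, so the binary digits of the parameter can simply be appended.
\<close>

definition digraph_bits :: "nat pair_pre_digraph \<Rightarrow> bool list" where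
  "digraph_bits G =
     (let n = card (pverts G) in
      replicate n True @ [False] @ map (\<lambda>e. e \<in> parcs G) (List.product [0..<n] [0..<n]))"

definition instance_bits :: "nat pair_pre_digraph \<times> int \<Rightarrow> bool list" where
  "instance_bits I = digraph_bits (fst I) @ int_bits (snd I)"


section \<open>Deterministic multi-tape Turing machines\<close>

text \<open>
  A tape is infinite in both directions and consists of its contents and the head position.
  Symbols are natural numbers, \<open>0\<close> being the blank. The states of \<open>M\<close> are
  \<open>0, \<dots>, num_states M\<close>; state \<open>0\<close> is initial and \<open>num_states M\<close> is the only halting state.
  In each step the machine reads the scanned symbol of every tape, and on every tape writes a symbol
  and then moves the head by at most one cell.
\<close>

datatype dir = MoveLeft | Stay | MoveRight

type_synonym tape = "(int \<Rightarrow> nat) \<times> int"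

record tm =
  num_tapes :: nat
  num_symbols :: nat
  num_states :: nat
  transition :: "nat \<Rightarrow> nat list \<Rightarrow> nat \<times> (nat \<times> dir) list"

definition wf_tm :: "tm \<Rightarrow> bool" where
  "wf_tm M \<longleftrightarrow>
     num_tapes M \<ge> 2 \<and> num_symbols M \<ge> 3 \<and>
     (\<forall>q syms. q < num_states M \<and> length syms = num_tapes M \<and> set syms \<subseteq> {0..<num_symbols M} \<longrightarrow>
        (case transition M q syms of (q', acts) \<Rightarrow>
           q' \<le> num_states M \<and> length acts = num_tapes M \<and>
           fst ` set acts \<subseteq> {0..<num_symbols M}))"

fun scanned :: "tape \<Rightarrow> nat" where
  "scanned (c, p) = c p"

fun offset :: "dir \<Rightarrow> int" where
  "offset MoveLeft = -1"
| "offset Stay = 0"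
| "offset MoveRight = 1"

fun act :: "nat \<times> dir \<Rightarrow> tape \<Rightarrow> tape" where
  "act (s, d) (c, p) = (c(p := s), p + offset d)"

type_synonym config = "nat \<times> tape list"

text \<open>Halting configurations are fixed points of the step function.\<close>

definition tm_step :: "tm \<Rightarrow> config \<Rightarrow> config" where
  "tm_step M = (\<lambda>(q, ts).
     if q = num_states M then (q, ts)
     else case transition M q (map scanned ts) of (q', acts) \<Rightarrow> (q', map2 act acts ts))"

definition bits_on_tape :: "bool list \<Rightarrow> int \<Rightarrow> nat" where
  "bits_on_tape w i =
     (if 0 \<le> i \<and> i < int (length w) then (if w ! nat i then 2 else 1) else 0)"

text \<open>The input is written on tape \<open>0\<close>; the other tapes are blank.\<close>

definition tm_init :: "tm \<Rightarrow> bool list \<Rightarrow> config" where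
  "tm_init M w = (0, (bits_on_tape w, 0) # replicate (num_tapes M - 1) (\<lambda>_. 0, 0))"

text \<open>The output is the whole contents of tape \<open>1\<close> after halting.\<close>

definition tm_halts_with :: "tm \<Rightarrow> bool list \<Rightarrow> nat \<Rightarrow> bool list \<Rightarrow> bool" where
  "tm_halts_with M w t w' \<longleftrightarrow>
     (case (tm_step M ^^ t) (tm_init M w) of (q, ts) \<Rightarrow>
        q = num_states M \<and> fst (ts ! 1) = bits_on_tape w')"

text \<open>
  The function \<open>F\<close> is computable on the domain \<open>D\<close> in time polynomial in the length of the encoded
  input; \<open>enc\<close> is the encoding of arguments and values.
\<close>

definition polytime_computable_on :: "'i set \<Rightarrow> ('i \<Rightarrow> bool list) \<Rightarrow> ('i \<Rightarrow> 'i) \<Rightarrow> bool" where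
  "polytime_computable_on D enc F \<longleftrightarrow>
     (\<exists>M (p :: nat poly). wf_tm M \<and>
        (\<forall>x \<in> D. \<exists>t \<le> poly p (length (enc x)). tm_halts_with M (enc x) t (enc (F x))))"

end

theory Submission
  imports Defs
begin

text \<open>
  Sources belong to every dominating set, so all of them can be merged into a single vertex. What is
  left to count are the non-sources. Choosing an in-neighbour for each of them gives a functional
  graph, which is 3-colourable because every subgraph of it has at most as many edges as vertices.
  The vertices outside a largest colour class dominate it, so \<open>m\<close> non-sources yield a nonblocker
  with at least \<open>m / 3\<close> vertices. If \<open>k \<le> (m + 1) div 3\<close>, the answer is yes; otherwise the graph with
  merged sources has \<open>m + 1 \<le> 3 * k - 1\<close> vertices.

  The Turing machine is obtained by compiling a structured program whose running time is bounded in a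
  timed big-step semantics.
\<close>


section \<open>Nonblockers of digraphs\<close>

text \<open>In terms of the complement B of a dominating set, the question is whether some B with at
  least k vertices has an in-neighbour outside B for each of its members. The order of the digraph
  drops out, and since a source is never in B, merging sources leaves k unchanged. The factor 3
  cannot be improved by counting non-sources alone: in a directed triangle B has at most one vertex.
  The threshold is chosen for the kernel size: k > (m + 1) div 3 means 3 * k \<ge> m + 2, which is
  the bound m + 1 \<le> 3 * k - 1 with the merged source included. The parameter is written in
  binary and can be exponential in the input length, so the machine must not count up to k. It
  decrements a binary counter 1 + (m + 1) div 3 times, whatever k is, and asks only whether the
  counter underflows. All tape entries are nonzero where heads are moved back, so that blanks can
  serve as end markers.\<close>

lemma directed_nonblocker_iff:
  assumes "finite (pverts G)"
  shows "directed_nonblocker G k \<longleftrightarrow>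
    (\<exists>B \<subseteq> pverts G. k \<le> int (card B) \<and> (\<forall>u \<in> B. \<exists>v \<in> pverts G - B. (v, u) \<in> parcs G))"
    (is "?L \<longleftrightarrow> ?R")
proof
  assume ?L
  then obtain S where S: "S \<subseteq> pverts G" "\<forall>u \<in> pverts G - S. \<exists>v \<in> S. (v, u) \<in> parcs G"
      "int (card S) \<le> int (card (pverts G)) - k"
    unfolding directed_nonblocker_def dominating_set_def by blast
  moreover have "card (pverts G - S) = card (pverts G) - card S" "card S \<le> card (pverts G)"
    using S(1) assms by (auto intro: card_Diff_subset card_mono finite_subset)
  moreover have "pverts G - (pverts G - S) = S"
    using S(1) by blast
  ultimately show ?R
    by (intro exI[of _ "pverts G - S"]) auto
next
  assume ?R
  then obtain B where B: "B \<subseteq> pverts G" "k \<le> int (card B)"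
      "\<forall>u \<in> B. \<exists>v \<in> pverts G - B. (v, u) \<in> parcs G"
    by blast
  moreover have "card (pverts G - B) = card (pverts G) - card B" "card B \<le> card (pverts G)"
    using B(1) assms by (auto intro: card_Diff_subset card_mono finite_subset)
  ultimately show ?L
    unfolding directed_nonblocker_def dominating_set_def
    by (intro exI[of _ "pverts G - B"]) auto
qed

text \<open>The fibres over W are disjoint subsets of W, so on average they have at most one
  element.\<close>

lemma exists_small_fibre:
  assumes "finite W" "W \<noteq> {}"
  shows "\<exists>w \<in> W. card {v \<in> W. f v = w} \<le> 1"
proof (rule ccontr)
  assume "\<not> ?thesis"
  then have "(\<Sum>w\<in>W. 2) \<le> (\<Sum>w\<in>W. card {v \<in> W. f v = w})"
    by (intro sum_mono) auto
  also have "\<dots> = card (\<Union>w\<in>W. {v \<in> W. f v = w})"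
    using assms by (subst card_UN_disjoint) auto
  also have "\<dots> \<le> card W"
    using assms by (intro card_mono) auto
  finally show False
    using assms by (simp add: card_gt_0_iff)
qed

text \<open>Delete a vertex w with at most one preimage x in W and colour the rest by induction. At
  w only the colours of x and of \<open>f w\<close> are forbidden, so a third one is free. Ignoring
  edges that leave W lets the statement pass to the smaller set.\<close>

lemma functional_graph_3_colourable:
  fixes f :: "'a \<Rightarrow> 'a"
  assumes "finite W" "\<And>v. v \<in> W \<Longrightarrow> f v \<noteq> v"
  shows "\<exists>c :: 'a \<Rightarrow> nat. (\<forall>v \<in> W. c v < 3) \<and> (\<forall>v \<in> W. f v \<in> W \<longrightarrow> c v \<noteq> c (f v))"
  using assms
proof (induction "card W" arbitrary: W)
  case 0
  then show ?case by simp
next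
  case (Suc n)
  then obtain w where w: "w \<in> W" "card {v \<in> W. f v = w} \<le> 1"
    using exists_small_fibre[of W f] by (metis card.empty nat.distinct(1))
  \<comment> \<open>If the fibre is empty, any x will do: avoiding its colour as well still leaves
    one of the three.\<close>
  obtain x where x: "{v \<in> W. f v = w} \<subseteq> {x}"
  proof (cases "{v \<in> W. f v = w} = {}")
    case False
    then obtain x where "x \<in> {v \<in> W. f v = w}" by blast
    then show ?thesis
      using w(2) \<open>finite W\<close> that[of x] by (auto simp: card_le_Suc0_iff_eq)
  qed auto
  have "n = card (W - {w})" "finite (W - {w})"
    using Suc.hyps(2) Suc.prems(1) w(1) by auto
  with Suc.hyps(1)[of "W - {w}"] Suc.prems(2) obtain c where
    c: "\<forall>v \<in> W - {w}. c v < (3::nat)" "\<forall>v \<in> W - {w}. f v \<in> W - {w} \<longrightarrow> c v \<noteq> c (f v)"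
    by auto
  obtain k :: nat where k: "k < 3" "k \<noteq> c x" "k \<noteq> c (f w)"
  proof -
    have "card ({..<3} - {c x, c (f w)}) \<ge> 1"
      by (rule order_trans[OF _ diff_card_le_card_Diff]) (auto simp: card_insert_if)
    then have "{..<3} - {c x, c (f w)} \<noteq> {}"
      by (intro notI) simp
    then show ?thesis
      using that by auto
  qed
  show ?case
  proof (intro exI[of _ "c(w := k)"] conjI ballI impI)
    fix v assume v: "v \<in> W" "f v \<in> W"
    show "(c(w := k)) v \<noteq> (c(w := k)) (f v)"
    proof (cases "f v = w")
      case True
      then have "v = x" using x v by auto
      then show ?thesis using True k Suc.prems(2)[OF v(1)] by auto
    next
      case False
      then show ?thesis using c v k by auto
    qed
  qed (use c k in auto)
qed

lemma functional_graph_independent_third: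
  assumes "finite W" "\<And>v. v \<in> W \<Longrightarrow> f v \<noteq> v"
  shows "\<exists>B \<subseteq> W. card W \<le> 3 * card B \<and> (\<forall>v \<in> B. f v \<notin> B)"
proof -
  obtain c :: "'a \<Rightarrow> nat"
    where c: "\<forall>v \<in> W. c v < 3" "\<forall>v \<in> W. f v \<in> W \<longrightarrow> c v \<noteq> c (f v)"
    using functional_graph_3_colourable[OF assms] by blast
  have "\<exists>i<3. card W \<le> 3 * card {v \<in> W. c v = i}"
  proof (rule ccontr)
    assume "\<not> ?thesis"
    then have small: "3 * card {v \<in> W. c v = i} < card W" if "i < 3" for i
      using that by (simp add: not_le)
    have "W = (\<Union>i<3. {v \<in> W. c v = i})"
      using c by auto
    then have "card W = (\<Sum>i<3. card {v \<in> W. c v = i})"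
      using assms(1) by (subst (1) \<open>W = _\<close>, subst card_UN_disjoint) auto
    then show False
      using small[of 0] small[of 1] small[of 2] by (simp add: eval_nat_numeral)
  qed
  then obtain i where "card W \<le> 3 * card {v \<in> W. c v = i}"
    by blast
  then show ?thesis
    using c by (intro exI[of _ "{v \<in> W. c v = i}"]) auto
qed

text \<open>The function f picks in-neighbours, and \<open>f v \<noteq> v\<close> because there are
  no loops. By independence \<open>f u\<close> lies outside B for u in B, be it a source or a
  non-source of another colour, so the complement of B dominates.\<close>

lemma directed_nonblocker_if_few:
  assumes "pair_digraph G" "k \<le> int ((card {v \<in> pverts G. \<exists>u. (u, v) \<in> parcs G} + 1) div 3)"
  shows "directed_nonblocker G k"
proof -
  interpret pair_digraph G by fact
  define W where "W = {v \<in> pverts G. \<exists>u. (u, v) \<in> parcs G}"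
  obtain f where f: "(f v, v) \<in> parcs G" if "v \<in> W" for v
    unfolding W_def by atomize_elim (auto intro!: choice)
  have "f v \<noteq> v" if "v \<in> W" for v
    using pair_no_loops[OF f[OF that]] by simp
  moreover have "finite W"
    unfolding W_def using pair_finite_verts by simp
  ultimately obtain B where B: "B \<subseteq> W" "card W \<le> 3 * card B" "\<forall>v \<in> B. f v \<notin> B"
    using functional_graph_independent_third[of W f] by blast
  show ?thesis
    unfolding directed_nonblocker_iff[OF pair_finite_verts]
  proof (intro exI[of _ B] conjI ballI)
    show "k \<le> int (card B)"
      using assms(2) B(2) unfolding W_def by linarith
    show "\<exists>v \<in> pverts G - B. (v, u) \<in> parcs G" if "u \<in> B" for u
      using that B f[of u] in_arcsD1 by blast
  qed (use B W_def in auto)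
qed


section \<open>The kernel\<close>

text \<open>A list rather than a set: its increasing order fixes the new numbering of the vertices
  and is the order in which the machine scans its tapes.\<close>

definition nonsources :: "nat pair_pre_digraph \<Rightarrow> nat list" where
  "nonsources G = filter (\<lambda>v. \<exists>u. (u, v) \<in> parcs G) [0..<card (pverts G)]"

definition source_dominated :: "'a pair_pre_digraph \<Rightarrow> 'a \<Rightarrow> bool" where
  "source_dominated G v \<longleftrightarrow> (\<exists>u. (u, v) \<in> parcs G \<and> (\<forall>t. (t, u) \<notin> parcs G))"

text \<open>Vertex \<open>0\<close> replaces all the sources of \<open>G\<close>; it is present even if \<open>G\<close> has no source.\<close>

definition merge_sources :: "nat pair_pre_digraph \<Rightarrow> nat pair_pre_digraph" where
  "merge_sources G = (let xs = nonsources G in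
     \<lparr> pverts = {0..<Suc (length xs)},
       parcs = {(0, Suc j) |j. j < length xs \<and> source_dominated G (xs ! j)} \<union>
         {(Suc i, Suc j) |i j. i < length xs \<and> j < length xs \<and> (xs ! i, xs ! j) \<in> parcs G} \<rparr>)"

text \<open>The empty digraph with parameter 0 is a fixed yes-instance. As the threshold is
  nonnegative, it also absorbs every k \<le> 0, so the merged digraph is returned only for positive
  k.\<close>

fun kernel :: "nat pair_pre_digraph \<times> int \<Rightarrow> nat pair_pre_digraph \<times> int" where
  "kernel (G, k) =
    (if k \<le> int ((length (nonsources G) + 1) div 3) then (\<lparr> pverts = {}, parcs = {} \<rparr>, 0)
     else (merge_sources G, k))"

lemma pverts_merge_sources: "pverts (merge_sources G) = {0..<Suc (length (nonsources G))}"
  by (simp add: merge_sources_def Let_def)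

lemma parcs_merge_sources_iff [simp]:
  "(x, 0) \<in> parcs (merge_sources G) \<longleftrightarrow> False"
  "(0, Suc j) \<in> parcs (merge_sources G) \<longleftrightarrow>
     j < length (nonsources G) \<and> source_dominated G (nonsources G ! j)"
  "(Suc i, Suc j) \<in> parcs (merge_sources G) \<longleftrightarrow>
     i < length (nonsources G) \<and> j < length (nonsources G) \<and>
     (nonsources G ! i, nonsources G ! j) \<in> parcs G"
  by (auto simp: merge_sources_def Let_def)

section \<open>Validity and equivalence of the kernel\<close>

lemma numbered_digraph_empty: "numbered_digraph \<lparr> pverts = {}, parcs = {} \<rparr>"
  unfolding numbered_digraph_def by (auto intro!: exI[of _ 0], unfold_locales) auto

lemma directed_nonblocker_empty: "directed_nonblocker \<lparr> pverts = {}, parcs = {} \<rparr> 0"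
  by (simp add: directed_nonblocker_def dominating_set_def)

context
  fixes G :: "nat pair_pre_digraph"
  assumes numbered: "numbered_digraph G"
begin

interpretation pair_digraph G
  using numbered by (simp add: numbered_digraph_def)

lemma pverts_numbered: "pverts G = {0..<card (pverts G)}"
  using numbered unfolding numbered_digraph_def by (metis card_atLeastLessThan diff_zero)

lemma parcs_bounded:
  assumes "(u, v) \<in> parcs G"
  shows "u < card (pverts G)" "v < card (pverts G)"
  using wellformed'[OF assms] pverts_numbered by (metis atLeastLessThan_iff)+

lemma set_nonsources: "set (nonsources G) = {v \<in> pverts G. \<exists>u. (u, v) \<in> parcs G}"
  using parcs_bounded in_arcsD2 by (auto simp: nonsources_def)

lemma distinct_nonsources: "distinct (nonsources G)"
  by (simp add: nonsources_def)

lemma numbered_digraph_merge_sources: "numbered_digraph (merge_sources G)"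
proof -
  have arc: "\<exists>j. snd e = Suc j \<and> j < length (nonsources G) \<and>
      (fst e = 0 \<or> (\<exists>i. fst e = Suc i \<and> i < length (nonsources G) \<and> i \<noteq> j))"
    if "e \<in> parcs (merge_sources G)" for e
    using that pair_no_loops[of "(x, x)" for x] by (auto simp: merge_sources_def Let_def) metis
  have wf: "fst e < Suc (length (nonsources G)) \<and> snd e < Suc (length (nonsources G)) \<and> fst e \<noteq> snd e"
    if "e \<in> parcs (merge_sources G)" for e
    using arc[OF that] by auto
  have "parcs (merge_sources G) \<subseteq> {..length (nonsources G)} \<times> {..length (nonsources G)}"
    using wf by (force simp: less_Suc_eq_le)
  then have "finite (parcs (merge_sources G))"
    by (rule finite_subset) simp
  then have "pair_digraph (merge_sources G)"
    using wf by unfold_locales (auto simp: pverts_merge_sources)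
  then show ?thesis
    unfolding numbered_digraph_def pverts_merge_sources by blast
qed

text \<open>On both sides B consists of vertices with in-neighbours, and these correspond to each
  other under the renumbering. Which source dominates a vertex is irrelevant, since no source is in
  B; so one representative suffices.\<close>

lemma directed_nonblocker_merge_sources:
  "directed_nonblocker (merge_sources G) k \<longleftrightarrow> directed_nonblocker G k"
proof
  let ?xs = "nonsources G"
  have fin: "finite (pverts (merge_sources G))"
    by (simp add: pverts_merge_sources)
  {
    assume "directed_nonblocker (merge_sources G) k"
    then obtain B where B: "B \<subseteq> pverts (merge_sources G)" "k \<le> int (card B)"
        "\<forall>u \<in> B. \<exists>v \<in> pverts (merge_sources G) - B. (v, u) \<in> parcs (merge_sources G)"
      unfolding directed_nonblocker_iff[OF fin] by blast
    \<comment> \<open>Vertex 0 has no in-arc, so it cannot belong to B. This also keeps the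
      truncated subtraction in \<open>?g\<close> from identifying 0 and 1.\<close>
    have no0: "0 \<notin> B"
      using B(3) by force
    let ?g = "\<lambda>i. ?xs ! (i - 1)"
    have inj: "inj_on ?g B"
    proof (rule inj_onI)
      fix i j assume ij: "i \<in> B" "j \<in> B" "?g i = ?g j"
      then obtain i' j' where "i = Suc i'" "j = Suc j'"
        using no0 by (metis not0_implies_Suc)
      then show "i = j"
        using ij B(1) nth_eq_iff_index_eq[OF distinct_nonsources, of i' j']
        by (auto simp: pverts_merge_sources subset_iff)
    qed
    have sub: "?g ` B \<subseteq> set ?xs"
    proof (rule image_subsetI)
      fix i assume "i \<in> B"
      then obtain i' where "i = Suc i'"
        using no0 by (cases i) auto
      then show "?g i \<in> set ?xs"
        using \<open>i \<in> B\<close> B(1) by (auto simp: pverts_merge_sources)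
    qed
    have nb: "\<exists>v \<in> pverts G - ?g ` B. (v, u) \<in> parcs G" if "u \<in> ?g ` B" for u
    proof -
      obtain i' where "i' \<in> B" "u = ?g i'"
        using \<open>u \<in> ?g ` B\<close> by blast
      then obtain i where i: "Suc i \<in> B" "u = ?xs ! i"
        using no0 by (cases i') auto
      then obtain v where v: "v \<in> pverts (merge_sources G) - B" "(v, Suc i) \<in> parcs (merge_sources G)"
        using B(3) by blast
      show ?thesis
      proof (cases v)
        \<comment> \<open>Here 0 stands for some source s of G, which is outside the image of B
          because that image contains only non-sources.\<close>
        case 0
        then obtain s where s: "(s, u) \<in> parcs G" "\<forall>t. (t, s) \<notin> parcs G"
          using v(2) i(2) by (auto simp: source_dominated_def)
        then have "s \<notin> set ?xs"
          by (auto simp: set_nonsources)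
        then show ?thesis
          using s sub in_arcsD1 by blast
      next
        case (Suc j)
        then have j: "j < length ?xs" "(?xs ! j, u) \<in> parcs G"
          using v i by auto
        have "?xs ! j \<noteq> ?g x" if "x \<in> B" for x
        proof -
          obtain x' where "x = Suc x'" using \<open>x \<in> B\<close> no0 by (cases x) auto
          then have "x' < length ?xs" "x' \<noteq> j"
            using that B(1) v(1) Suc by (auto simp: pverts_merge_sources)
          then show ?thesis
            using \<open>x = Suc x'\<close> j(1) distinct_nonsources by (simp add: nth_eq_iff_index_eq)
        qed
        then show ?thesis
          using j in_arcsD1 by blast
      qed
    qed
    show "directed_nonblocker G k"
      unfolding directed_nonblocker_iff[OF pair_finite_verts]
      using B(2) sub nb by (intro exI[of _ "?g ` B"]) (auto simp: set_nonsources card_image[OF inj, simplified])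
  }
  {
    assume "directed_nonblocker G k"
    then obtain B where B: "B \<subseteq> pverts G" "k \<le> int (card B)"
        "\<forall>u \<in> B. \<exists>v \<in> pverts G - B. (v, u) \<in> parcs G"
      unfolding directed_nonblocker_iff[OF pair_finite_verts] by blast
    have sub: "B \<subseteq> set ?xs"
      using B(1,3) by (auto simp: set_nonsources)
    define B' where "B' = {Suc i |i. i < length ?xs \<and> ?xs ! i \<in> B}"
    \<comment> \<open>A surjection from B' onto B is enough, since only the lower bound on the size
      has to carry over.\<close>
    have "B \<subseteq> (\<lambda>i. ?xs ! (i - 1)) ` B'"
    proof
      fix u assume u: "u \<in> B"
      then obtain i where "i < length ?xs" "?xs ! i = u"
        using sub by (metis in_set_conv_nth subsetD)
      then show "u \<in> (\<lambda>i. ?xs ! (i - 1)) ` B'"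
        using u by (intro image_eqI[of _ _ "Suc i"]) (auto simp: B'_def)
    qed
    then have card: "card B \<le> card B'"
      by (rule surj_card_le[rotated]) (simp add: B'_def)
    have nb: "\<exists>v \<in> pverts (merge_sources G) - B'. (v, u) \<in> parcs (merge_sources G)" if "u \<in> B'" for u
    proof -
      obtain i where i: "u = Suc i" "i < length ?xs" "?xs ! i \<in> B"
        using \<open>u \<in> B'\<close> by (auto simp: B'_def)
      then obtain v where v: "v \<in> pverts G" "v \<notin> B" "(v, ?xs ! i) \<in> parcs G"
        using B(3) by blast
      show ?thesis
      \<comment> \<open>A dominator in \<open>?xs\<close> has its own copy; any other dominator is a
        source and is represented by 0.\<close>
      proof (cases "v \<in> set ?xs")
        case True
        then obtain j where "j < length ?xs" "?xs ! j = v"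
          by (auto simp: in_set_conv_nth)
        then show ?thesis
          using i v by (intro bexI[of _ "Suc j"]) (auto simp: B'_def pverts_merge_sources)
      next
        case False
        then have "source_dominated G (?xs ! i)"
          using v by (auto simp: set_nonsources source_dominated_def)
        then show ?thesis
          using i by (intro bexI[of _ 0]) (auto simp: B'_def pverts_merge_sources)
      qed
    qed
    show "directed_nonblocker (merge_sources G) k"
      unfolding directed_nonblocker_iff[OF fin]
      using B(2) card nb by (intro exI[of _ B']) (auto simp: B'_def pverts_merge_sources)
  }
qed

lemma kernel_correct:
  assumes "kernel (G, k) = (G', k')"
  shows "numbered_digraph G'"
    and "directed_nonblocker G' k' \<longleftrightarrow> directed_nonblocker G k"
    and "\<bar>k'\<bar> \<le> \<bar>k\<bar>"
    and "k \<ge> 1 \<Longrightarrow> int (card (pverts G')) \<le> 3 * k - 1"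
proof -
  have "length (nonsources G) = card {v \<in> pverts G. \<exists>u. (u, v) \<in> parcs G}"
    using distinct_card[OF distinct_nonsources] set_nonsources by simp
  then have yes: "directed_nonblocker G k" if "k \<le> int ((length (nonsources G) + 1) div 3)"
    using directed_nonblocker_if_few[OF pair_digraph_axioms] that by simp
  show "numbered_digraph G'" "directed_nonblocker G' k' \<longleftrightarrow> directed_nonblocker G k"
    "\<bar>k'\<bar> \<le> \<bar>k\<bar>" "k \<ge> 1 \<Longrightarrow> int (card (pverts G')) \<le> 3 * k - 1"
    using assms yes numbered_digraph_empty directed_nonblocker_empty numbered_digraph_merge_sources
      directed_nonblocker_merge_sources
    by (auto simp: pverts_merge_sources split: if_splits)
qed

end


section \<open>Structured programs for Turing machines\<close>

text \<open>The functions in a program are applied to the list of the symbols scanned on all tapes.\<close>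

datatype prog =
    Act nat "nat list \<Rightarrow> nat" dir
  | Seq prog prog (infixr ";;" 60)
  | Cond "nat list \<Rightarrow> bool" prog prog
  | While "nat list \<Rightarrow> bool" prog

text \<open>Times are exact, so that they can be used as iteration counts of \<open>tm_step\<close>.
  A test costs one step because it occupies a state of its own; sequencing is free because the exit
  of p is the entry of q.\<close>

inductive exec :: "prog \<Rightarrow> tape list \<Rightarrow> nat \<Rightarrow> tape list \<Rightarrow> bool" where
  exec_Act: "exec (Act j f d) ts 1 (ts[j := act (f (map scanned ts), d) (ts ! j)])"
| exec_Seq: "exec p ts t us \<Longrightarrow> exec q us t' vs \<Longrightarrow> exec (p ;; q) ts (t + t') vs"
| exec_Cond_True: "b (map scanned ts) \<Longrightarrow> exec p ts t us \<Longrightarrow> exec (Cond b p q) ts (Suc t) us"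
| exec_Cond_False: "\<not> b (map scanned ts) \<Longrightarrow> exec q ts t us \<Longrightarrow> exec (Cond b p q) ts (Suc t) us"
| exec_While_False: "\<not> b (map scanned ts) \<Longrightarrow> exec (While b p) ts 1 ts"
| exec_While_True: "b (map scanned ts) \<Longrightarrow> exec p ts t us \<Longrightarrow> exec (While b p) us t' vs \<Longrightarrow>
    exec (While b p) ts (Suc (t + t')) vs"

fun prog_size :: "prog \<Rightarrow> nat" where
  "prog_size (Act j f d) = 1"
| "prog_size (p ;; q) = prog_size p + prog_size q"
| "prog_size (Cond b p q) = Suc (prog_size p + prog_size q)"
| "prog_size (While b p) = Suc (prog_size p)"

definition idle :: "nat list \<Rightarrow> (nat \<times> dir) list" where
  "idle syms = map (\<lambda>s. (s, Stay)) syms"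

text \<open>State \<^term>\<open>0\<close> of a program is its entry, state \<^term>\<open>prog_size p\<close> its exit.\<close>

fun prog_trans :: "prog \<Rightarrow> nat \<Rightarrow> nat list \<Rightarrow> nat \<times> (nat \<times> dir) list" where
  "prog_trans (Act j f d) n syms = (1, (idle syms)[j := (f syms, d)])"
| "prog_trans (p ;; q) n syms =
    (if n < prog_size p then prog_trans p n syms
     else map_prod (\<lambda>m. m + prog_size p) id (prog_trans q (n - prog_size p) syms))"
| "prog_trans (Cond b p q) n syms =
    (if n = 0 then (if b syms then 1 else Suc (prog_size p), idle syms)
     else if n \<le> prog_size p then
       map_prod (\<lambda>m. if m = prog_size p then Suc (prog_size p + prog_size q) else Suc m) id
         (prog_trans p (n - 1) syms)
     else map_prod (\<lambda>m. Suc (m + prog_size p)) id (prog_trans q (n - Suc (prog_size p)) syms))"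
| "prog_trans (While b p) n syms =
    (if n = 0 then (if b syms then 1 else Suc (prog_size p), idle syms)
     else map_prod (\<lambda>m. if m = prog_size p then 0 else Suc m) id (prog_trans p (n - 1) syms))"

lemma prog_size_nonzero [simp]: "prog_size p \<noteq> 0"
  by (induction p) auto

lemma prog_size_pos [simp]: "0 < prog_size p"
  by (rule gr0I) simp

lemma act_idle: "act (scanned t, Stay) t = t"
  by (cases t) simp

lemma map2_act_idle: "map2 act (idle (map scanned ts)) ts = ts"
  by (rule nth_equalityI) (auto simp: idle_def act_idle)

lemma map2_act_idle_update:
  "map2 act ((idle (map scanned ts))[j := a]) ts = ts[j := act a (ts ! j)]"
proof (cases "j < length ts")
  case True
  have "map2 act ((idle (map scanned ts))[j := a]) (ts[j := ts ! j]) =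
      (map2 act (idle (map scanned ts)) ts)[j := act a (ts ! j)]"
    unfolding zip_update map_update by simp
  then show ?thesis
    by (simp add: map2_act_idle)
next
  case False
  then show ?thesis
    using map2_act_idle[of ts] by (simp add: list_update_beyond idle_def)
qed

text \<open>
  The map \<open>g\<close> places the states of a subprogram into the machine; exits of subprograms are placed
  at the state where control continues, so \<open>g\<close> need not be injective.
\<close>

lemma tm_step_exec:
  assumes "exec p ts t us"
    and "\<And>n. n < prog_size p \<Longrightarrow> g n \<noteq> num_states M"
    and "\<And>n syms. n < prog_size p \<Longrightarrow> transition M (g n) syms = map_prod g id (prog_trans p n syms)"
  shows "(tm_step M ^^ t) (g 0, ts) = (g (prog_size p), us)"
  using assms
proof (induction arbitrary: g rule: exec.induct)
  case (exec_Act j f d ts)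
  then show ?case
    by (simp add: tm_step_def map2_act_idle_update)
next
  case (exec_Seq p ts t us q t' vs)
  have "(tm_step M ^^ t) (g 0, ts) = (g (prog_size p), us)"
    using exec_Seq.prems by (intro exec_Seq.IH(1)) auto
  \<comment> \<open>Writing \<open>0 + prog_size p\<close> exhibits the placement
    \<open>\<lambda>n. g (n + prog_size p)\<close> of q, for which the induction hypothesis is
    used.\<close>
  moreover have "(tm_step M ^^ t') (g (0 + prog_size p), us) = (g (prog_size q + prog_size p), vs)"
    using exec_Seq.prems
    by (intro exec_Seq.IH(2)) (auto simp: map_prod_def split: prod.splits)
  ultimately show ?case
    by (simp add: funpow_add add.commute[of t] add.commute[of "prog_size q"])
next
  case (exec_Cond_True b ts p t us q)
  let ?g = "\<lambda>n. g (if n = prog_size p then Suc (prog_size p + prog_size q) else Suc n)"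
  have "tm_step M (g 0, ts) = (g 1, ts)"
    using exec_Cond_True.prems(1,2)[of 0] exec_Cond_True.hyps
    by (simp add: tm_step_def map2_act_idle)
  moreover have "(tm_step M ^^ t) (?g 0, ts) = (?g (prog_size p), us)"
    using exec_Cond_True.prems
    by (intro exec_Cond_True.IH) (auto simp: map_prod_def split: prod.splits)
  ultimately show ?case
    by (simp add: funpow_swap1 del: funpow.simps add: funpow_Suc_right)
next
  case (exec_Cond_False b ts q t us p)
  let ?g = "\<lambda>n. g (Suc (n + prog_size p))"
  have "tm_step M (g 0, ts) = (g (Suc (prog_size p)), ts)"
    using exec_Cond_False.prems(1,2)[of 0] exec_Cond_False.hyps
    by (simp add: tm_step_def map2_act_idle)
  moreover have "(tm_step M ^^ t) (?g 0, ts) = (?g (prog_size q), us)"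
    using exec_Cond_False.prems
    by (intro exec_Cond_False.IH) (auto simp: map_prod_def split: prod.splits)
  ultimately show ?case
    by (simp del: funpow.simps add: funpow_Suc_right add.commute)
next
  case (exec_While_False b ts p)
  then show ?case
    using exec_While_False.prems(1,2)[of 0]
    by (simp add: tm_step_def map2_act_idle)
next
  case (exec_While_True b ts p t us t' vs)
  let ?g = "\<lambda>n. g (if n = prog_size p then 0 else Suc n)"
  have "tm_step M (g 0, ts) = (g 1, ts)"
    using exec_While_True.prems(1,2)[of 0] exec_While_True.hyps
    by (simp add: tm_step_def map2_act_idle)
  moreover have "(tm_step M ^^ t) (?g 0, ts) = (?g (prog_size p), us)"
    using exec_While_True.prems
    by (intro exec_While_True.IH(1)) (auto simp: map_prod_def split: prod.splits)
  \<comment> \<open>Every iteration reuses the same states, so the rest of the loop runs under the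
    unchanged g.\<close>
  moreover have "(tm_step M ^^ t') (g 0, us) = (g (prog_size (While b p)), vs)"
    using exec_While_True.prems by (intro exec_While_True.IH(2)) auto
  ultimately show ?case
    by (simp del: funpow.simps add: funpow_Suc_right add.commute[of t] funpow_add)
qed

section \<open>From programs to well-formed machines\<close>

fun wf_prog :: "nat \<Rightarrow> nat \<Rightarrow> prog \<Rightarrow> bool" where
  "wf_prog k s (Act j f d) \<longleftrightarrow>
     (\<forall>syms. length syms = k \<and> set syms \<subseteq> {0..<s} \<longrightarrow> f syms < s)"
| "wf_prog k s (p ;; q) \<longleftrightarrow> wf_prog k s p \<and> wf_prog k s q"
| "wf_prog k s (Cond b p q) \<longleftrightarrow> wf_prog k s p \<and> wf_prog k s q"
| "wf_prog k s (While b p) \<longleftrightarrow> wf_prog k s p"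

definition prog_tm :: "nat \<Rightarrow> nat \<Rightarrow> prog \<Rightarrow> tm" where
  "prog_tm k s p =
    \<lparr> num_tapes = k, num_symbols = s, num_states = prog_size p, transition = prog_trans p \<rparr>"

lemma prog_trans_wf:
  assumes "wf_prog k s p" "n < prog_size p" "length syms = k" "set syms \<subseteq> {0..<s}"
  shows "fst (prog_trans p n syms) \<le> prog_size p \<and> length (snd (prog_trans p n syms)) = k \<and>
    fst ` set (snd (prog_trans p n syms)) \<subseteq> {0..<s}"
  using assms
proof (induction p arbitrary: n)
  case (Act j f d)
  have "set ((idle syms)[j := (f syms, d)]) \<subseteq> insert (f syms, d) (set (idle syms))"
    by (intro set_update_subset_insert)
  moreover have "f syms < s" "fst ` set (idle syms) \<subseteq> {0..<s}"
    using Act by (auto simp: idle_def)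
  ultimately show ?case
    using Act by (fastforce simp: idle_def)
next
  case (Seq p q)
  show ?case
  proof (cases "n < prog_size p")
    case True
    then show ?thesis using Seq.IH(1)[of n] Seq.prems by auto
  next
    case False
    then show ?thesis using Seq.IH(2)[of "n - prog_size p"] Seq.prems by auto
  qed
next
  case (Cond b p q)
  consider "n = 0" | "0 < n" "n \<le> prog_size p" | "prog_size p < n"
    by linarith
  then show ?case
  proof cases
    case 1
    then show ?thesis using Cond.prems by (auto simp: idle_def)
  next
    case 2
    then show ?thesis using Cond.IH(1)[of "n - 1"] Cond.prems by (auto intro: trans_le_add1)
  next
    case 3
    then show ?thesis using Cond.IH(2)[of "n - Suc (prog_size p)"] Cond.prems by auto
  qed
next
  case (While b p)
  show ?case
  proof (cases "n = 0")
    case True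
    then show ?thesis using While.prems by (auto simp: idle_def)
  next
    case False
    then show ?thesis using While.IH[of "n - 1"] While.prems by auto
  qed
qed

lemma wf_tm_prog_tm:
  assumes "wf_prog k s p" "2 \<le> k" "3 \<le> s"
  shows "wf_tm (prog_tm k s p)"
  using assms prog_trans_wf[OF assms(1)]
  by (simp add: wf_tm_def prog_tm_def case_prod_unfold)

text \<open>Under the identity placement the exit of the program is the halting state of the
  machine.\<close>

lemma tm_halts_with_prog_tm:
  assumes "exec p (snd (tm_init (prog_tm k s p) w)) t us" "fst (us ! 1) = bits_on_tape w'"
  shows "tm_halts_with (prog_tm k s p) w t w'"
proof -
  have "(tm_step (prog_tm k s p) ^^ t) (id 0, snd (tm_init (prog_tm k s p) w)) = (id (prog_size p), us)"
    by (rule tm_step_exec[OF assms(1)]) (auto simp: prog_tm_def id_def map_prod_def split: prod.splits)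
  then show ?thesis
    using assms(2) by (simp add: tm_halts_with_def tm_init_def prog_tm_def)
qed


section \<open>Programs with time bounds\<close>

text \<open>Upper bounds instead of exact times allow branches and iterations of different cost to
  be joined under one bound.\<close>

definition runs :: "prog \<Rightarrow> tape list \<Rightarrow> nat \<Rightarrow> tape list \<Rightarrow> bool" where
  "runs p ts T us \<longleftrightarrow> (\<exists>t \<le> T. exec p ts t us)"

lemma runs_Act: "runs (Act j f d) ts 1 (ts[j := act (f (map scanned ts), d) (ts ! j)])"
  unfolding runs_def using exec_Act by blast

lemma runs_Seq: "runs p ts T us \<Longrightarrow> runs q us T' vs \<Longrightarrow> runs (p ;; q) ts (T + T') vs"
  unfolding runs_def using exec_Seq add_mono by blast

lemma runs_Cond:
  assumes "b (map scanned ts) \<Longrightarrow> runs p ts T us" "\<not> b (map scanned ts) \<Longrightarrow> runs q ts T us"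
  shows "runs (Cond b p q) ts (Suc T) us"
  using assms exec_Cond_True[of b ts p _ us q] exec_Cond_False[of b ts q _ us p]
  unfolding runs_def by (metis Suc_le_mono)

lemma runs_mono: "runs p ts T us \<Longrightarrow> T \<le> T' \<Longrightarrow> runs p ts T' us"
  unfolding runs_def using order_trans by blast

text \<open>The loop is described by the explicit sequence \<open>st\<close> of its states. Each of
  the n iterations pays one step for its test, and the final failing test pays the additional
  1.\<close>

lemma runs_While:
  assumes "\<And>i. i < n \<Longrightarrow> b (map scanned (st i))" "\<And>i. i < n \<Longrightarrow> runs p (st i) T (st (Suc i))"
    and "\<not> b (map scanned (st n))"
  shows "runs (While b p) (st 0) (n * Suc T + 1) (st n)"
proof -
  have "runs (While b p) (st (n - i)) (i * Suc T + 1) (st n)" if "i \<le> n" for i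
    using that
  proof (induction i)
    case 0
    then show ?case
      using exec_While_False[of b "st n" p] assms(3) by (auto simp: runs_def)
  next
    case (Suc i)
    then have "Suc (n - Suc i) = n - i" "n - Suc i < n" by auto
    then obtain t t' where t: "t \<le> T" "exec p (st (n - Suc i)) t (st (n - i))"
        "t' \<le> i * Suc T + 1" "exec (While b p) (st (n - i)) t' (st n)"
      using Suc assms(2)[of "n - Suc i"] unfolding runs_def by auto
    then have "exec (While b p) (st (n - Suc i)) (Suc (t + t')) (st n)"
      using assms(1)[OF \<open>n - Suc i < n\<close>] by (intro exec_While_True)
    moreover have "Suc (t + t') \<le> Suc i * Suc T + 1"
      using t(1,3) by simp
    ultimately show ?case
      unfolding runs_def by blast
  qed
  from this[of n] show ?thesis by simp
qed

section \<open>Straight-line programs\<close>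

fun loop_free :: "prog \<Rightarrow> bool" where
  "loop_free (Act j f d) \<longleftrightarrow> True"
| "loop_free (p ;; q) \<longleftrightarrow> loop_free p \<and> loop_free q"
| "loop_free (Cond b p q) \<longleftrightarrow> loop_free p \<and> loop_free q"
| "loop_free (While b p) \<longleftrightarrow> False"

fun result :: "prog \<Rightarrow> tape list \<Rightarrow> tape list" where
  "result (Act j f d) ts = ts[j := act (f (map scanned ts), d) (ts ! j)]"
| "result (p ;; q) ts = result q (result p ts)"
| "result (Cond b p q) ts = (if b (map scanned ts) then result p ts else result q ts)"
| "result (While b p) ts = ts"

text \<open>A loop-free program enters none of its states twice, so \<open>prog_size\<close> bounds
  its time. Loop bodies without inner loops are thereby verified by simplifying
  \<open>result\<close>.\<close>

lemma runs_loop_free: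
  assumes "loop_free p" "result p ts = us" "prog_size p \<le> T"
  shows "runs p ts T us"
proof -
  have "runs p ts (prog_size p) (result p ts)" if "loop_free p" for p ts
    using that
  proof (induction p arbitrary: ts)
    case (Act j f d)
    then show ?case using runs_Act by simp
  next
    case (Seq p q)
    then show ?case using runs_Seq[OF Seq.IH(1) Seq.IH(2)] by simp
  next
    case (Cond b p q)
    have "runs p ts (prog_size p + prog_size q) (result p ts)" if "loop_free p"
      using Cond.IH(1)[OF that, of ts] by (rule runs_mono) simp
    moreover have "runs q ts (prog_size p + prog_size q) (result q ts)" if "loop_free q"
      using Cond.IH(2)[OF that, of ts] by (rule runs_mono) simp
    ultimately show ?case
      using Cond.prems by (auto intro: runs_Cond)
  qed simp
  then show ?thesis
    using assms runs_mono by blast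
qed


section \<open>Tapes holding lists\<close>

definition tape_at :: "nat list \<Rightarrow> nat \<Rightarrow> tape" where
  "tape_at xs i = ((\<lambda>j. if 0 \<le> j \<and> j < int (length xs) then xs ! nat j else 0), int i)"

text \<open>With entries given by a function on vertices, writing a cell is a function update, and a
  loop invariant can distinguish the cells on either side of the head by
  \<open>if j < v\<close>.\<close>

definition vec :: "nat \<Rightarrow> (nat \<Rightarrow> nat) \<Rightarrow> nat \<Rightarrow> tape" where
  "vec n f = tape_at (map f [0..<n])"

definition bit_symbol :: "bool \<Rightarrow> nat" where
  "bit_symbol b = (if b then 2 else 1)"

lemma bit_symbol_eq_iff [simp]: "bit_symbol b = 2 \<longleftrightarrow> b" "bit_symbol b = Suc 0 \<longleftrightarrow> \<not> b" "bit_symbol b \<noteq> 0" "0 < bit_symbol b"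
  by (auto simp: bit_symbol_def)

lemma scanned_tape_at [simp]: "scanned (tape_at xs i) = (if i < length xs then xs ! i else 0)"
  by (simp add: tape_at_def)

lemma scanned_vec [simp]: "scanned (vec n f i) = (if i < n then f i else 0)"
  by (simp add: vec_def)

lemma act_overwrite [simp]:
  assumes "i < length xs"
  shows "act (s, MoveRight) (tape_at xs i) = tape_at (xs[i := s]) (Suc i)"
    and "act (s, Stay) (tape_at xs i) = tape_at (xs[i := s]) i"
  using assms by (auto simp: tape_at_def fun_eq_iff nth_list_update)

lemma act_append [simp]:
  "act (s, MoveRight) (tape_at xs (length xs)) = tape_at (xs @ [s]) (Suc (length xs))"
  by (auto simp: tape_at_def fun_eq_iff nth_append nat_eq_iff)

lemma act_vec [simp]: "i < n \<Longrightarrow> act (s, MoveRight) (vec n f i) = vec n (f(i := s)) (Suc i)"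
  unfolding vec_def
  by (simp, rule arg_cong[where f = "\<lambda>xs. tape_at xs _"], rule nth_equalityI) (auto simp: nth_list_update)

lemma act_vec_append [simp]: "act (s, MoveRight) (vec n f n) = vec (Suc n) (f(n := s)) (Suc n)"
proof -
  have "map (f(n := s)) [0..<Suc n] = map f [0..<n] @ [s]"
    by simp
  then show ?thesis
    using act_append[of s "map f [0..<n]"] by (simp add: vec_def del: upt_Suc)
qed

lemma vec_cong: "(\<And>j. j < n \<Longrightarrow> f j = g j) \<Longrightarrow> vec n f i = vec n g i"
  unfolding vec_def by (rule arg_cong[where f = "\<lambda>xs. tape_at xs i"]) simp

text \<open>The blank symbol is 0, so an untouched tape can be read as a single cell holding 0; this
  is how tapes 6 and 7 start.\<close>

lemma tape_at_Nil: "tape_at [] 0 = tape_at [0] 0"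
  by (auto simp: tape_at_def)

lemma fst_tape_at: "fst (tape_at (map bit_symbol w) i) = bits_on_tape w"
  by (auto simp: tape_at_def bits_on_tape_def bit_symbol_def fun_eq_iff)

lemma tape_at_bits: "(bits_on_tape w, 0) = tape_at (map bit_symbol w) 0"
  by (auto simp: tape_at_def bits_on_tape_def bit_symbol_def fun_eq_iff)

lemma list_update_numeral [simp]:
  "(x # xs)[numeral v := y] = x # xs[pred_numeral v := y]"
  by (simp add: numeral_eq_Suc)

fun shift :: "dir \<Rightarrow> tape \<Rightarrow> tape" where
  "shift d (c, p) = (c, p + offset d)"

lemma act_scanned: "act (scanned t, d) t = shift d t"
  by (cases t) simp

definition mv :: "nat \<Rightarrow> dir \<Rightarrow> prog" where
  "mv j d = Act j (\<lambda>syms. syms ! j) d"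

definition put :: "nat \<Rightarrow> nat \<Rightarrow> dir \<Rightarrow> prog" where
  "put j x d = Act j (\<lambda>_. x) d"

lemma loop_free_mv_put [simp]: "loop_free (mv j d)" "loop_free (put j x d)"
    "prog_size (mv j d) = 1" "prog_size (put j x d) = 1"
  by (simp_all add: mv_def put_def)

lemma result_mv [simp]: "j < length ts \<Longrightarrow> result (mv j d) ts = ts[j := shift d (ts ! j)]"
  by (simp add: mv_def act_scanned)

lemma result_put [simp]: "result (put j x d) ts = ts[j := act (x, d) (ts ! j)]"
  by (simp add: put_def)

lemma shift_tape_at [simp]:
  "shift MoveRight (tape_at xs i) = tape_at xs (Suc i)"
  "shift Stay t = t"
  by (simp add: tape_at_def, cases t) simp

lemma shift_vec [simp]: "shift MoveRight (vec n f i) = vec n f (Suc i)"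
  by (simp add: vec_def)

text \<open>The first move is unconditional because the head may stand on the blank behind the last
  entry. The loop then stops on the blank at position -1, provided that no entry is 0, and the last
  move corrects this.\<close>

definition rewind :: "nat \<Rightarrow> prog" where
  "rewind j = mv j MoveLeft ;; While (\<lambda>syms. syms ! j \<noteq> 0) (mv j MoveLeft) ;; mv j MoveRight"

lemma runs_rewind:
  assumes "j < length ts" "ts ! j = tape_at xs i" "i \<le> length xs" "0 \<notin> set xs"
  shows "runs (rewind j) ts (2 * i + 3) (ts[j := tape_at xs 0])"
proof -
  define st where "st m = ts[j := (fst (tape_at xs i), int i - 1 - int m)]" for m
  have "runs (mv j MoveLeft) ts 1 (st 0)"
    using assms by (intro runs_loop_free) (auto simp: st_def tape_at_def)
  moreover have "runs (While (\<lambda>syms. syms ! j \<noteq> 0) (mv j MoveLeft)) (st 0) (i * Suc 1 + 1) (st i)"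
  proof (rule runs_While)
    fix m assume "m < i"
    then have "nat (int i - 1 - int m) < length xs"
      using assms(3) by auto
    then show "map scanned (st m) ! j \<noteq> 0"
      using assms \<open>m < i\<close> by (auto simp: st_def tape_at_def in_set_conv_nth)
    show "runs (mv j MoveLeft) (st m) 1 (st (Suc m))"
      using assms(1) by (intro runs_loop_free) (auto simp: st_def)
  qed (use assms(1) in \<open>simp add: st_def tape_at_def\<close>)
  moreover have "runs (mv j MoveRight) (st i) 1 (ts[j := tape_at xs 0])"
    using assms by (intro runs_loop_free) (auto simp: st_def tape_at_def)
  ultimately have "runs (rewind j) ts (1 + (i * Suc 1 + 1 + 1)) (ts[j := tape_at xs 0])"
    unfolding rewind_def by (intro runs_Seq)
  then show ?thesis
    by (rule runs_mono) simp
qed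

lemma runs_rewind_vec:
  assumes "j < length ts" "ts ! j = vec n f i" "i \<le> n" "\<And>v. v < n \<Longrightarrow> f v \<noteq> 0"
  shows "runs (rewind j) ts (2 * i + 3) (ts[j := vec n f 0])"
  using runs_rewind[of j ts "map f [0..<n]" i] assms by (force simp: vec_def)


section \<open>Decrementing a binary counter\<close>

text \<open>The digits are tape symbols, 1 for the bit zero and 2 for the bit one, least significant
  first. The borrow runs through the leading 1s; a counter of value 0 wraps around to all
  2s.\<close>

fun dec :: "nat list \<Rightarrow> nat list" where
  "dec [] = []"
| "dec (x # xs) = (if x = 1 then 2 # dec xs else 1 # xs)"

fun bits_val :: "nat list \<Rightarrow> nat" where
  "bits_val [] = 0"
| "bits_val (x # xs) = (if x = 2 then 1 else 0) + 2 * bits_val xs"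

lemma length_dec [simp]: "length (dec xs) = length xs"
  by (induction xs) auto

lemma set_dec: "set xs \<subseteq> {1, 2} \<Longrightarrow> set (dec xs) \<subseteq> {1, 2}"
  by (induction xs) auto

lemma bits_val_eq_0_iff: "bits_val xs = 0 \<longleftrightarrow> 2 \<notin> set xs"
  by (induction xs) auto

lemma bits_val_dec:
  "set xs \<subseteq> {1, 2} \<Longrightarrow> bits_val xs > 0 \<Longrightarrow> bits_val (dec xs) = bits_val xs - 1"
  by (induction xs) (auto split: if_splits)

lemma bits_val_nat_bits: "bits_val (map bit_symbol (nat_bits n)) = n"
proof (induction n rule: nat_bits.induct)
  case (1 n)
  then show ?case
    by (subst nat_bits.simps) (auto simp: odd_two_times_div_two_succ)
qed

lemma dec_conv_takeWhile:
  assumes "z = length (takeWhile (\<lambda>x. x = 1) xs)"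
  shows "dec xs = (if z < length xs then replicate z 2 @ 1 # drop (Suc z) xs else replicate z 2)"
  unfolding assms by (induction xs) auto

text \<open>The second component is the underflow flag. It is set when a counter without any digit
  2, hence of value 0, is decremented, and it is never reset.\<close>

fun dec_step :: "nat list \<times> nat \<Rightarrow> nat list \<times> nat" where
  "dec_step (xs, f) = (dec xs, if 2 \<in> set xs then f else 2)"

text \<open>After wrapping around, the value of the counter is meaningless, so it is described only
  up to the underflow; from then on the flag carries the information.\<close>

lemma dec_step_funpow:
  assumes "set xs \<subseteq> {1, 2}"
  shows "length (fst ((dec_step ^^ J) (xs, 0))) = length xs \<and>
    set (fst ((dec_step ^^ J) (xs, 0))) \<subseteq> {1, 2} \<and>
    (J \<le> bits_val xs \<longrightarrow> bits_val (fst ((dec_step ^^ J) (xs, 0))) = bits_val xs - J) \<and>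
    snd ((dec_step ^^ J) (xs, 0)) = (if J \<le> bits_val xs then 0 else 2)"
proof (induction J)
  case 0
  then show ?case using assms by simp
next
  case (Suc J)
  obtain ys f where "(dec_step ^^ J) (xs, 0) = (ys, f)"
    by fastforce
  with Suc have ys: "length ys = length xs" "set ys \<subseteq> {1, 2}"
      "J \<le> bits_val xs \<Longrightarrow> bits_val ys = bits_val xs - J" "f = (if J \<le> bits_val xs then 0 else 2)"
    by auto
  have "(dec_step ^^ Suc J) (xs, 0) = (dec ys, if bits_val ys = 0 then 2 else f)"
    using \<open>(dec_step ^^ J) (xs, 0) = (ys, f)\<close> by (simp add: bits_val_eq_0_iff)
  moreover have "bits_val (dec ys) = bits_val xs - Suc J" if "Suc J \<le> bits_val xs"
    using bits_val_dec[OF ys(2)] ys(3) that by simp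
  ultimately show ?case
    using ys set_dec[OF ys(2)] by simp
qed

definition decrement :: prog where
  "decrement = While (\<lambda>syms. syms ! 5 = 1) (put 5 2 MoveRight) ;;
     Cond (\<lambda>syms. syms ! 5 = 0) (put 6 2 Stay) (put 5 1 Stay) ;; rewind 5"

text \<open>The loop turns the z leading 1s into 2s. The head then stands either on the digit 2 that
  pays the borrow or on the blank behind the counter, which is the underflow.\<close>

lemma runs_decrement:
  assumes "set xs \<subseteq> {1, 2}" "dec_step (xs, f) = (ys, f')"
  shows "runs decrement [t0, t1, t2, t3, t4, tape_at xs 0, tape_at [f] 0, t7]
    (4 * length xs + 8) [t0, t1, t2, t3, t4, tape_at ys 0, tape_at [f'] 0, t7]"
proof -
  define z where "z = length (takeWhile (\<lambda>x. x = 1) xs)"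
  have z: "z \<le> length xs" "\<And>i. i < z \<Longrightarrow> xs ! i = 1"
  proof -
    show "z \<le> length xs"
      unfolding z_def by (rule length_takeWhile_le)
    show "xs ! i = 1" if "i < z" for i
      using that set_takeWhileD[OF nth_mem[of i "takeWhile (\<lambda>x. x = 1) xs"]]
      by (simp add: z_def takeWhile_nth)
  qed
  define st where
    "st i = [t0, t1, t2, t3, t4, tape_at (replicate i 2 @ drop i xs) i, tape_at [f] 0, t7]" for i
  let ?us = "[t0, t1, t2, t3, t4, tape_at ys z, tape_at [f'] 0, t7]"
  have nz: "xs ! z = 2" if "z < length xs"
    using nth_length_takeWhile[of "\<lambda>x. x = 1" xs, folded z_def, OF that] nth_mem[OF that] assms(1) by auto
  have mem: "2 \<in> set xs \<longleftrightarrow> z < length xs"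
    using nz z unfolding in_set_conv_nth
    by (metis le_neq_implies_less numeral_eq_one_iff semiring_norm(85))
  have ys: "ys = (if z < length xs then replicate z 2 @ 1 # drop (Suc z) xs else replicate z 2)"
    "f' = (if z < length xs then f else 2)"
    using assms(2) dec_conv_takeWhile[OF z_def] mem by auto
  have "runs (While (\<lambda>syms. syms ! 5 = 1) (put 5 2 MoveRight)) (st 0) (z * Suc 1 + 1) (st z)"
  proof (rule runs_While)
    fix i assume i: "i < z"
    then show "map scanned (st i) ! 5 = 1"
      using z by (simp add: st_def nth_append)
    have "(replicate i 2 @ drop i xs)[i := 2] = replicate (Suc i) 2 @ drop (Suc i) xs"
      using i z(1)
      by (simp add: list_update_append replicate_app_Cons_same flip: Cons_nth_drop_Suc)
    then show "runs (put 5 2 MoveRight) (st i) 1 (st (Suc i))"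
      using i z(1) by (intro runs_loop_free) (auto simp: st_def)
  next
    show "\<not> map scanned (st z) ! 5 = 1"
      using nz z(1) by (auto simp: st_def nth_append)
  qed
  moreover have "runs (Cond (\<lambda>syms. syms ! 5 = 0) (put 6 2 Stay) (put 5 1 Stay)) (st z) 3 ?us"
    using nz z(1)
    by (intro runs_loop_free)
      (auto simp: st_def ys nth_append list_update_append Cons_nth_drop_Suc[symmetric])
  moreover have "runs (rewind 5) ?us (2 * z + 3) (?us[5 := tape_at ys 0])"
  proof (rule runs_rewind)
    show "0 \<notin> set ys" "z \<le> length ys"
      using set_dec[OF assms(1)] assms(2) z(1) by auto
  qed auto
  ultimately have "runs decrement (st 0) (z * Suc 1 + 1 + (3 + (2 * z + 3))) (?us[5 := tape_at ys 0])"
    unfolding decrement_def by (intro runs_Seq)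
  then show ?thesis
    using z(1) by (auto simp: st_def elim!: runs_mono)
qed


section \<open>The kernelization program\<close>

text \<open>
  Tape 2 holds for every vertex the symbol \<open>2\<close> if it has an in-neighbour and \<open>1\<close> otherwise; its head
  runs through the columns of the adjacency matrix. Tape 3 is a copy of it whose head runs through
  the rows. Tape 4 marks the vertices dominated by sources. Tape 5 is a binary counter initialized
  with the parameter, tape 6 is marked as soon as the counter underflows, and tape 7 is a counter
  modulo \<open>3\<close>.
\<close>

definition prepare :: prog where
  "prepare = put 7 1 Stay ;;
     While (\<lambda>s. s ! 0 = 2)
       (mv 0 MoveRight ;; put 2 1 MoveRight ;; put 3 1 MoveRight ;; put 4 1 MoveRight) ;;
     mv 0 MoveRight ;; rewind 2 ;; rewind 3 ;; rewind 4"

text \<open>The encoded matrix has no row separators; the blank behind the n cells of tape 2 tells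
  that a row is complete.\<close>

definition mark_row :: prog where
  "mark_row = While (\<lambda>s. s ! 2 \<noteq> 0)
     (Act 2 (\<lambda>s. if s ! 0 = 2 then 2 else s ! 2) MoveRight ;; mv 0 MoveRight)"

text \<open>While the marks are being computed, tape 3 is merely a unary counter for the rows; it
  becomes a copy of tape 2 afterwards.\<close>

definition mark_nonsources :: prog where
  "mark_nonsources =
     While (\<lambda>s. s ! 3 \<noteq> 0) (mark_row ;; rewind 2 ;; mv 3 MoveRight) ;; rewind 3 ;;
     While (\<lambda>s. s ! 2 \<noteq> 0) (Act 3 (\<lambda>s. s ! 2) MoveRight ;; mv 2 MoveRight) ;;
     rewind 2 ;; rewind 3"

definition load_parameter :: prog where
  "load_parameter =
     While (\<lambda>s. s ! 0 \<noteq> 0) (Act 5 (\<lambda>s. s ! 0) MoveRight ;; mv 0 MoveRight) ;; rewind 5"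

definition skip :: prog where
  "skip = mv 7 Stay"

text \<open>
  Tape 7 starts at \<open>1\<close> and the counter is decremented once in advance, so for \<open>m\<close> non-sources there
  are \<open>1 + (m + 1) div 3\<close> decrements, and the counter underflows iff the parameter is at most
  \<open>(m + 1) div 3\<close>.
\<close>

definition count_nonsources :: prog where
  "count_nonsources = decrement ;;
     While (\<lambda>s. s ! 2 \<noteq> 0)
       (Cond (\<lambda>s. s ! 2 = 2)
         (Act 7 (\<lambda>s. (s ! 7 + 1) mod 3) Stay ;; Cond (\<lambda>s. s ! 7 = 0) decrement skip) skip ;;
        mv 2 MoveRight) ;;
     rewind 2"

definition goto_matrix :: prog where
  "goto_matrix = rewind 0 ;; While (\<lambda>s. s ! 0 = 2) (mv 0 MoveRight) ;; mv 0 MoveRight"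

definition mark_dominated_row :: prog where
  "mark_dominated_row = While (\<lambda>s. s ! 2 \<noteq> 0)
     (Act 4 (\<lambda>s. if s ! 3 = 1 \<and> s ! 0 = 2 then 2 else s ! 4) MoveRight ;;
      mv 0 MoveRight ;; mv 2 MoveRight)"

definition mark_dominated :: prog where
  "mark_dominated =
     While (\<lambda>s. s ! 3 \<noteq> 0) (mark_dominated_row ;; rewind 2 ;; rewind 4 ;; mv 3 MoveRight) ;; rewind 3"

text \<open>The 2 written in advance counts vertex 0, and the final 1 closes the unary
  order.\<close>

definition write_order :: prog where
  "write_order = put 1 2 MoveRight ;;
     While (\<lambda>s. s ! 2 \<noteq> 0) (Cond (\<lambda>s. s ! 2 = 2) (put 1 2 MoveRight) skip ;; mv 2 MoveRight) ;;
     rewind 2 ;; put 1 1 MoveRight"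

text \<open>The initial 1 is the entry of column 0, which is never entered by an arc;
  \<open>write_row\<close> starts with it for the same reason.\<close>

definition write_source_row :: prog where
  "write_source_row = put 1 1 MoveRight ;;
     While (\<lambda>s. s ! 2 \<noteq> 0)
       (Cond (\<lambda>s. s ! 2 = 2) (Act 1 (\<lambda>s. s ! 4) MoveRight) skip ;; mv 2 MoveRight ;; mv 4 MoveRight) ;;
     rewind 2"

definition write_row :: prog where
  "write_row = Cond (\<lambda>s. s ! 3 = 2) (put 1 1 MoveRight) skip ;;
     While (\<lambda>s. s ! 2 \<noteq> 0)
       (Cond (\<lambda>s. s ! 2 = 2 \<and> s ! 3 = 2) (Act 1 (\<lambda>s. s ! 0) MoveRight) skip ;;
        mv 0 MoveRight ;; mv 2 MoveRight)"

definition write_rows :: prog where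
  "write_rows = While (\<lambda>s. s ! 3 \<noteq> 0) (write_row ;; rewind 2 ;; mv 3 MoveRight)"

definition write_parameter :: prog where
  "write_parameter =
     While (\<lambda>s. s ! 0 \<noteq> 0) (Act 1 (\<lambda>s. s ! 0) MoveRight ;; mv 0 MoveRight)"

text \<open>The code of the empty digraph with parameter 0: the end of the empty unary order, an
  empty matrix, the nonnegative sign and no digits.\<close>

definition write_yes :: prog where
  "write_yes = put 1 1 MoveRight ;; put 1 1 MoveRight"

definition write_kernel :: prog where
  "write_kernel = goto_matrix ;; mark_dominated ;; goto_matrix ;;
     write_order ;; write_source_row ;; write_rows ;; write_parameter"

text \<open>The counter will hold only the absolute value of the parameter, so the sign, which
  follows the matrix on tape 0, is tested beforehand.\<close>

definition kernelize :: prog where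
  "kernelize = prepare ;; mark_nonsources ;;
     Cond (\<lambda>s. s ! 0 = 2) write_yes
       (mv 0 MoveRight ;; load_parameter ;; count_nonsources ;;
        Cond (\<lambda>s. s ! 6 = 2) write_yes write_kernel)"

lemma wf_prog_kernelize: "wf_prog 8 3 kernelize"
proof -
  have nth: "syms ! j < (3 :: nat)" if "length syms = 8" "set syms \<subseteq> {0..<3}" "j < 8" for syms j
    using that subsetD[OF that(2) nth_mem[of j]] by simp
  have "wf_prog 8 3 (mv j d)" if "j < 8" for j d
    using that nth by (simp add: mv_def)
  moreover have "wf_prog 8 3 (put j x d)" if "x < 3" for j x d
    using that by (simp add: put_def)
  ultimately show ?thesis
    unfolding kernelize_def prepare_def mark_row_def mark_nonsources_def load_parameter_def skip_def
      count_nonsources_def goto_matrix_def mark_dominated_row_def mark_dominated_def write_order_def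
      write_source_row_def write_row_def write_rows_def write_parameter_def write_yes_def
      write_kernel_def rewind_def decrement_def
    by (simp add: nth)
qed

definition out_tape :: "nat list \<Rightarrow> tape" where
  "out_tape xs = tape_at xs (length xs)"

lemma act_out_tape [simp]: "act (s, MoveRight) (out_tape xs) = out_tape (xs @ [s])"
  by (simp add: out_tape_def)

lemma result_skip [simp]:
  "loop_free skip" "prog_size skip = 1"
  "result skip [t0, t1, t2, t3, t4, t5, t6, t7] = [t0, t1, t2, t3, t4, t5, t6, t7]"
  by (simp_all add: skip_def)

lemma runs_rewind_2:
  assumes "i \<le> n" "\<And>v. f v \<noteq> 0"
  shows "runs (rewind 2) [t0, t1, vec n f i, t3, t4, t5, t6, t7] (2 * n + 3)
    [t0, t1, vec n f 0, t3, t4, t5, t6, t7]"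
  using runs_rewind_vec[of 2 "[t0, t1, vec n f i, t3, t4, t5, t6, t7]" n f i] assms
  by (auto elim: runs_mono)

lemma runs_rewind_3:
  assumes "i \<le> n" "\<And>v. f v \<noteq> 0"
  shows "runs (rewind 3) [t0, t1, t2, vec n f i, t4, t5, t6, t7] (2 * n + 3)
    [t0, t1, t2, vec n f 0, t4, t5, t6, t7]"
  using runs_rewind_vec[of 3 "[t0, t1, t2, vec n f i, t4, t5, t6, t7]" n f i] assms
  by (auto elim: runs_mono)

lemma runs_rewind_4:
  assumes "i \<le> n" "\<And>v. f v \<noteq> 0"
  shows "runs (rewind 4) [t0, t1, t2, t3, vec n f i, t5, t6, t7] (2 * n + 3)
    [t0, t1, t2, t3, vec n f 0, t5, t6, t7]"
  using runs_rewind_vec[of 4 "[t0, t1, t2, t3, vec n f i, t5, t6, t7]" n f i] assms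
  by (auto elim: runs_mono)

text \<open>The quotient grows exactly when the residue wraps to 0. This ties the counter modulo 3
  to the number of decrements.\<close>

lemma div3_step:
  fixes x :: nat
  shows "(x + 2) mod 3 = 0 \<Longrightarrow> (x + 2) div 3 = Suc ((x + 1) div 3)"
    and "(x + 2) mod 3 \<noteq> 0 \<Longrightarrow> (x + 2) div 3 = (x + 1) div 3"
  by presburger+

text \<open>The program is analysed on an arbitrary Boolean matrix; digraphs enter only when the
  encodings are compared.\<close>

locale matrix_input =
  fixes n :: nat and A :: "nat \<Rightarrow> nat \<Rightarrow> bool" and neg :: bool and ks :: "nat list"
  assumes ks: "set ks \<subseteq> {1, 2}"
begin

definition W :: "nat list" where
  "W = replicate n 2 @ [1] @ map (\<lambda>(u, v). bit_symbol (A u v)) (List.product [0..<n] [0..<n]) @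
     bit_symbol neg # ks"

lemma length_W: "length W = Suc (Suc (n + n * n + length ks))"
  by (simp add: W_def)

lemma W_order: "i < n \<Longrightarrow> W ! i = 2" "W ! n = Suc 0"
  by (simp_all add: W_def nth_append)

lemma matrix_index_less: "u < n \<Longrightarrow> v < n \<Longrightarrow> u * n + v < n * n"
  by (metis add.commute add_less_cancel_left less_le_trans mult_Suc mult_le_mono1 Suc_leI)

lemma W_matrix:
  assumes "u < n" "v < n"
  shows "W ! Suc (n + u * n + v) = bit_symbol (A u v)" "Suc (n + u * n + v) < length W"
proof -
  note less = matrix_index_less[OF assms]
  have "(u * n + v) div n = u" "(u * n + v) mod n = v"
    using assms by auto
  then show "W ! Suc (n + u * n + v) = bit_symbol (A u v)"
    using less assms by (simp add: W_def nth_append product_nth)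
  show "Suc (n + u * n + v) < length W"
    using less by (simp add: length_W)
qed

lemma W_parameter:
  "W ! Suc (n + n * n) = bit_symbol neg"
  "i < length ks \<Longrightarrow> W ! Suc (Suc (n + n * n + i)) = ks ! i"
  by (simp_all add: W_def nth_append)

lemma W_nonzero: "0 \<notin> set W"
  using ks by (auto simp: W_def)

text \<open>Not a degree but the mark of v on tape 2 after the rows below u have been read. In the
  same way \<open>dominated\<close> describes tape 4 during its pass over the rows.\<close>

definition indeg :: "nat \<Rightarrow> nat \<Rightarrow> nat" where
  "indeg u v = bit_symbol (\<exists>t<u. A t v)"

abbreviation nonsource :: "nat \<Rightarrow> nat" where
  "nonsource \<equiv> indeg n"

definition dominated :: "nat \<Rightarrow> nat \<Rightarrow> nat" where
  "dominated u v = bit_symbol (\<exists>t<u. nonsource t = 1 \<and> A t v)"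

lemma indeg_0: "indeg 0 = (\<lambda>_. 1)"
  by (simp add: indeg_def bit_symbol_def fun_eq_iff)

lemma dominated_0: "dominated 0 = (\<lambda>_. 1)"
  by (simp add: dominated_def bit_symbol_def fun_eq_iff)

lemma indeg_Suc: "indeg (Suc u) v = (if A u v then 2 else indeg u v)"
  by (auto simp: indeg_def bit_symbol_def less_Suc_eq)

lemma dominated_Suc:
  "dominated (Suc u) v = (if nonsource u = 1 \<and> A u v then 2 else dominated u v)"
  by (auto simp: dominated_def bit_symbol_def less_Suc_eq)

lemma marks_nonzero [simp]: "indeg u v \<noteq> 0" "dominated u v \<noteq> 0" "0 < indeg u v" "0 < dominated u v"
  by (simp_all add: indeg_def dominated_def)

section \<open>Reading the input and marking non-sources\<close>

lemma runs_prepare: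
  "runs prepare [tape_at W 0, t1, tape_at [] 0, tape_at [] 0, tape_at [] 0, t5, t6, tape_at [] 0]
    (11 * n + 12)
    [tape_at W (Suc n), t1, vec n (\<lambda>_. 1) 0, vec n (\<lambda>_. 1) 0, vec n (\<lambda>_. 1) 0, t5, t6, tape_at [1] 0]"
proof -
  define st where "st i = [tape_at W i, t1, vec i (\<lambda>_. 1) i, vec i (\<lambda>_. 1) i, vec i (\<lambda>_. 1) i, t5, t6,
    tape_at [1] 0]" for i
  have "runs (put 7 1 Stay)
      [tape_at W 0, t1, tape_at [] 0, tape_at [] 0, tape_at [] 0, t5, t6, tape_at [] 0] 1 (st 0)"
    by (intro runs_loop_free) (simp_all add: st_def vec_def tape_at_Nil[THEN arg_cong, of "act _"])
  moreover have "runs (While (\<lambda>s. s ! 0 = 2)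
       (mv 0 MoveRight ;; put 2 1 MoveRight ;; put 3 1 MoveRight ;; put 4 1 MoveRight))
       (st 0) (n * Suc 4 + 1) (st n)"
    by (rule runs_While)
      (auto simp: st_def W_order length_W fun_upd_def intro!: runs_loop_free)
  moreover have "runs (mv 0 MoveRight) (st n) 1
      [tape_at W (Suc n), t1, vec n (\<lambda>_. 1) n, vec n (\<lambda>_. 1) n, vec n (\<lambda>_. 1) n, t5, t6, tape_at [1] 0]"
    by (intro runs_loop_free) (simp_all add: st_def)
  ultimately show ?thesis
    unfolding prepare_def
    by - (rule runs_mono, (rule runs_Seq runs_rewind_2 runs_rewind_3 runs_rewind_4 order_refl | assumption | simp)+)
qed

lemma runs_mark_row:
  assumes "u < n"
  shows "runs mark_row [tape_at W (Suc (n + u * n)), t1, vec n (indeg u) 0, t3, t4, t5, t6, t7]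
    (3 * n + 1) [tape_at W (Suc (n + u * n + n)), t1, vec n (indeg (Suc u)) n, t3, t4, t5, t6, t7]"
proof -
  define st where "st v = [tape_at W (Suc (n + u * n + v)), t1,
    vec n (\<lambda>j. if j < v then indeg (Suc u) j else indeg u j) v, t3, t4, t5, t6, t7]" for v
  have "runs mark_row (st 0) (n * Suc 2 + 1) (st n)"
    unfolding mark_row_def
  proof (rule runs_While)
    fix v assume "v < n"
    then show "runs (Act 2 (\<lambda>s. if s ! 0 = 2 then 2 else s ! 2) MoveRight ;; mv 0 MoveRight)
        (st v) 2 (st (Suc v))"
      using assms by (intro runs_loop_free)
        (auto simp: st_def W_matrix indeg_Suc intro!: vec_cong)
  qed (auto simp: st_def)
  moreover have "st n = [tape_at W (Suc (n + u * n + n)), t1, vec n (indeg (Suc u)) n, t3, t4, t5, t6, t7]"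
    by (auto simp: st_def intro: vec_cong)
  ultimately show ?thesis
    by (simp add: st_def mult.commute)
qed

lemma runs_mark_nonsources:
  "runs mark_nonsources
    [tape_at W (Suc n), t1, vec n (\<lambda>_. 1) 0, vec n (\<lambda>_. 1) 0, t4, t5, t6, t7] (5 * n * n + 15 * n + 11)
    [tape_at W (Suc (n + n * n)), t1, vec n nonsource 0, vec n nonsource 0, t4, t5, t6, t7]"
proof -
  define st where
    "st u = [tape_at W (Suc (n + u * n)), t1, vec n (indeg u) 0, vec n (\<lambda>_. 1) u, t4, t5, t6, t7]" for u
  define st' where "st' v = [tape_at W (Suc (n + n * n)), t1, vec n nonsource v,
    vec n (\<lambda>j. if j < v then nonsource j else 1) v, t4, t5, t6, t7]" for v
  have "runs (While (\<lambda>s. s ! 3 \<noteq> 0) (mark_row ;; rewind 2 ;; mv 3 MoveRight)) (st 0)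
      (n * Suc (3 * n + 1 + (2 * n + 3 + 1)) + 1) (st n)"
  proof (rule runs_While)
    fix u assume u: "u < n"
    have step: "runs (mv 3 MoveRight) [tape_at W (Suc (n + u * n + n)), t1, vec n (indeg (Suc u)) 0,
        vec n (\<lambda>_. 1) u, t4, t5, t6, t7] 1 (st (Suc u))"
      by (intro runs_loop_free) (simp_all add: st_def algebra_simps)
    show "runs (mark_row ;; rewind 2 ;; mv 3 MoveRight) (st u)
        (3 * n + 1 + (2 * n + 3 + 1)) (st (Suc u))"
      unfolding st_def[of u] by (rule runs_Seq[OF runs_mark_row[OF u] runs_Seq[OF runs_rewind_2 step]]) simp_all
  qed (auto simp: st_def)
  moreover have "runs (rewind 3) (st n) (2 * n + 3) (st' 0)"
    using runs_rewind_3[of n n "\<lambda>_. 1"] by (simp add: st_def st'_def)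
  moreover have "runs (While (\<lambda>s. s ! 2 \<noteq> 0) (Act 3 (\<lambda>s. s ! 2) MoveRight ;; mv 2 MoveRight)) (st' 0)
      (n * Suc 2 + 1) [tape_at W (Suc (n + n * n)), t1, vec n nonsource n, vec n nonsource n, t4, t5, t6, t7]"
  proof -
    have "st' n = [tape_at W (Suc (n + n * n)), t1, vec n nonsource n, vec n nonsource n, t4, t5, t6, t7]"
      by (auto simp: st'_def intro: vec_cong)
    moreover have "runs (While (\<lambda>s. s ! 2 \<noteq> 0) (Act 3 (\<lambda>s. s ! 2) MoveRight ;; mv 2 MoveRight)) (st' 0)
        (n * Suc 2 + 1) (st' n)"
      by (rule runs_While) (auto simp: st'_def intro!: runs_loop_free vec_cong)
    ultimately show ?thesis
      by simp
  qed
  ultimately have "runs mark_nonsources (st 0)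
    (n * Suc (3 * n + 1 + (2 * n + 3 + 1)) + 1 + (2 * n + 3 + (n * Suc 2 + 1 + (2 * n + 3 + (2 * n + 3)))))
    [tape_at W (Suc (n + n * n)), t1, vec n nonsource 0, vec n nonsource 0, t4, t5, t6, t7]"
    unfolding mark_nonsources_def
    by - ((rule runs_Seq runs_rewind_2 runs_rewind_3 order_refl marks_nonzero | assumption)+)
  then show ?thesis
    by (auto simp: st_def indeg_0 algebra_simps elim!: runs_mono)
qed

lemma runs_load_parameter:
  "runs load_parameter [tape_at W (Suc (Suc (n + n * n))), t1, t2, t3, t4, tape_at [] 0, t6, t7]
    (5 * length ks + 4) [tape_at W (length W), t1, t2, t3, t4, tape_at ks 0, t6, t7]"
proof -
  define st where "st i = [tape_at W (Suc (Suc (n + n * n + i))), t1, t2, t3, t4,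
    out_tape (take i ks), t6, t7]" for i
  have "ks ! i \<noteq> 0" if "i < length ks" for i
    using ks nth_mem[OF that] by auto
  then have "runs (While (\<lambda>s. s ! 0 \<noteq> 0) (Act 5 (\<lambda>s. s ! 0) MoveRight ;; mv 0 MoveRight)) (st 0)
      (length ks * Suc 2 + 1) (st (length ks))"
    by (intro runs_While)
      (auto simp: st_def W_parameter length_W take_Suc_conv_app_nth intro!: runs_loop_free)
  moreover have "runs (rewind 5) (st (length ks)) (2 * length ks + 3)
      ((st (length ks))[5 := tape_at ks 0])"
    using ks by (intro runs_rewind) (auto simp: st_def out_tape_def)
  ultimately have "runs load_parameter (st 0) (length ks * Suc 2 + 1 + (2 * length ks + 3))
      ((st (length ks))[5 := tape_at ks 0])"
    unfolding load_parameter_def by (rule runs_Seq)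
  then show ?thesis
    by (auto simp: st_def out_tape_def length_W elim!: runs_mono)
qed

section \<open>Comparing the parameter with a third of the non-sources\<close>

abbreviation nonsources_below :: "nat \<Rightarrow> nat list" where
  "nonsources_below v \<equiv> filter (\<lambda>j. nonsource j = 2) [0..<v]"

definition decrements :: "nat \<Rightarrow> nat" where
  "decrements v = 1 + (length (nonsources_below v) + 1) div 3"

definition counter :: "nat \<Rightarrow> nat list \<times> nat" where
  "counter J = (dec_step ^^ J) (ks, 0)"

lemma runs_decrement_counter:
  "runs decrement [t0, t1, t2, t3, t4, tape_at (fst (counter J)) 0, tape_at [snd (counter J)] 0, t7]
    (4 * length ks + 8)
    [t0, t1, t2, t3, t4, tape_at (fst (counter (Suc J))) 0, tape_at [snd (counter (Suc J))] 0, t7]"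
proof -
  obtain xs f ys f' where eq: "counter J = (xs, f)" "dec_step (xs, f) = (ys, f')"
    by fastforce
  then have "set xs \<subseteq> {1, 2}" "length xs = length ks" "counter (Suc J) = (ys, f')"
    using dec_step_funpow[OF ks, of J] by (simp_all add: counter_def del: dec_step.simps)
  then show ?thesis
    using runs_decrement[OF _ eq(2)] by (simp add: eq(1))
qed

lemma runs_count_nonsources:
  "runs count_nonsources
    [t0, t1, vec n nonsource 0, t3, t4, tape_at ks 0, tape_at [] 0, tape_at [1] 0]
    (n * (4 * length ks + 15) + 4 * length ks + 12)
    [t0, t1, vec n nonsource 0, t3, t4, tape_at (fst (counter (decrements n))) 0,
     tape_at [snd (counter (decrements n))] 0, tape_at [(length (nonsources_below n) + 1) mod 3] 0]"
proof -
  define st where "st v = [t0, t1, vec n nonsource v, t3, t4,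
    tape_at (fst (counter (decrements v))) 0, tape_at [snd (counter (decrements v))] 0,
    tape_at [(length (nonsources_below v) + 1) mod 3] 0]" for v
  have "runs decrement [t0, t1, vec n nonsource 0, t3, t4, tape_at ks 0, tape_at [] 0, tape_at [1] 0]
      (4 * length ks + 8) (st 0)"
    \<comment> \<open>\<open>counter 0\<close> is the loaded parameter with flag 0; tape 6 is still
      blank and is read as that flag.\<close>
    using runs_decrement_counter[of t0 t1 "vec n nonsource 0" t3 t4 0 "tape_at [1] 0"]
    by (simp add: st_def counter_def decrements_def tape_at_Nil)
  moreover have "runs (While (\<lambda>s. s ! 2 \<noteq> 0)
       (Cond (\<lambda>s. s ! 2 = 2)
         (Act 7 (\<lambda>s. (s ! 7 + 1) mod 3) Stay ;; Cond (\<lambda>s. s ! 7 = 0) decrement skip) skip ;;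
        mv 2 MoveRight)) (st 0) (n * Suc (4 * length ks + 12) + 1) (st n)"
  proof (rule runs_While)
    fix v assume v: "v < n"
    \<comment> \<open>The state after v has been counted but before the head of tape 2 moves on; all
      branches have to meet in it.\<close>
    let ?us = "(st (Suc v))[2 := vec n nonsource v]"
    have move: "runs (mv 2 MoveRight) ?us 1 (st (Suc v))"
      by (intro runs_loop_free) (simp_all add: st_def)
    have "runs (Cond (\<lambda>s. s ! 2 = 2)
        (Act 7 (\<lambda>s. (s ! 7 + 1) mod 3) Stay ;; Cond (\<lambda>s. s ! 7 = 0) decrement skip) skip)
        (st v) (Suc (1 + Suc (4 * length ks + 8))) ?us"
    proof (rule runs_Cond)
      assume "map scanned (st v) ! 2 = 2"
      then have ns: "nonsource v = 2"
        using v by (simp add: st_def)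
      let ?m = "(length (nonsources_below v) + 2) mod 3"
      let ?vs = "(st v)[7 := tape_at [?m] 0]"
      have "runs (Act 7 (\<lambda>s. (s ! 7 + 1) mod 3) Stay) (st v) 1 ?vs"
        by (intro runs_loop_free) (simp_all add: st_def mod_simps)
      moreover have "runs (Cond (\<lambda>s. s ! 7 = 0) decrement skip) ?vs (Suc (4 * length ks + 8)) ?us"
      proof (rule runs_Cond)
        assume "map scanned ?vs ! 7 = 0"
        then have "?m = 0"
          by (simp add: st_def)
        then have "decrements (Suc v) = Suc (decrements v)" "(length (nonsources_below (Suc v)) + 1) mod 3 = 0"
          using ns div3_step[of "length (nonsources_below v)"] by (simp_all add: decrements_def)
        then show "runs decrement ?vs (4 * length ks + 8) ?us"
          using \<open>?m = 0\<close> runs_decrement_counter by (simp add: st_def)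
      next
        assume "map scanned ?vs ! 7 \<noteq> 0"
        then have "?m \<noteq> 0"
          by (simp add: st_def)
        then have "decrements (Suc v) = decrements v" "(length (nonsources_below (Suc v)) + 1) mod 3 = ?m"
          using ns div3_step[of "length (nonsources_below v)"] by (simp_all add: decrements_def)
        then show "runs skip ?vs (4 * length ks + 8) ?us"
          by (intro runs_loop_free) (simp_all add: st_def)
      qed
      ultimately show "runs (Act 7 (\<lambda>s. (s ! 7 + 1) mod 3) Stay ;; Cond (\<lambda>s. s ! 7 = 0) decrement skip)
          (st v) (1 + Suc (4 * length ks + 8)) ?us"
        by (rule runs_Seq)
    next
      assume "map scanned (st v) ! 2 \<noteq> 2"
      then have "nonsource v \<noteq> 2"
        using v by (simp add: st_def)
      then show "runs skip (st v) (1 + Suc (4 * length ks + 8)) ?us"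
        by (intro runs_loop_free) (simp_all add: st_def decrements_def)
    qed
    from runs_Seq[OF this move] show "runs (Cond (\<lambda>s. s ! 2 = 2)
        (Act 7 (\<lambda>s. (s ! 7 + 1) mod 3) Stay ;; Cond (\<lambda>s. s ! 7 = 0) decrement skip) skip ;;
        mv 2 MoveRight) (st v) (4 * length ks + 12) (st (Suc v))"
      by (rule runs_mono) simp
  qed (auto simp: st_def)
  moreover have "runs (rewind 2) (st n) (2 * n + 3) ((st n)[2 := vec n nonsource 0])"
    unfolding st_def using runs_rewind_2[of n n nonsource] by simp
  ultimately have "runs count_nonsources
      [t0, t1, vec n nonsource 0, t3, t4, tape_at ks 0, tape_at [] 0, tape_at [1] 0]
      (4 * length ks + 8 + (n * Suc (4 * length ks + 12) + 1 + (2 * n + 3)))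
      ((st n)[2 := vec n nonsource 0])"
    unfolding count_nonsources_def by (intro runs_Seq)
  then show ?thesis
    by (auto simp: st_def algebra_simps elim!: runs_mono)
qed

lemma underflow: "snd (counter (decrements n)) = (if decrements n \<le> bits_val ks then 0 else 2)"
  using dec_step_funpow[OF ks] by (simp add: counter_def)

section \<open>Writing the merged digraph\<close>

lemma runs_goto_matrix:
  assumes "i \<le> length W"
  shows "runs goto_matrix [tape_at W i, t1, t2, t3, t4, t5, t6, t7] (2 * length W + 2 * n + 5)
    [tape_at W (Suc n), t1, t2, t3, t4, t5, t6, t7]"
proof -
  define st where "st i = [tape_at W i, t1, t2, t3, t4, t5, t6, t7]" for i
  have "runs (rewind 0) (st i) (2 * i + 3) (st 0)"
    using runs_rewind[of 0 "st i" W i] W_nonzero assms by (simp add: st_def)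
  moreover have "runs (While (\<lambda>s. s ! 0 = 2) (mv 0 MoveRight)) (st 0) (n * Suc 1 + 1) (st n)"
    by (rule runs_While) (auto simp: st_def W_order length_W intro!: runs_loop_free)
  moreover have "runs (mv 0 MoveRight) (st n) 1 (st (Suc n))"
    by (intro runs_loop_free) (simp_all add: st_def)
  ultimately have "runs goto_matrix (st i) (2 * i + 3 + (n * Suc 1 + 1 + 1)) (st (Suc n))"
    unfolding goto_matrix_def by (intro runs_Seq)
  then show ?thesis
    using assms by (auto simp: st_def elim!: runs_mono)
qed

lemma runs_mark_dominated_row:
  assumes "u < n"
  shows "runs mark_dominated_row
    [tape_at W (Suc (n + u * n)), t1, vec n nonsource 0, vec n nonsource u, vec n (dominated u) 0, t5, t6, t7]
    (4 * n + 1)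
    [tape_at W (Suc (n + u * n + n)), t1, vec n nonsource n, vec n nonsource u,
     vec n (dominated (Suc u)) n, t5, t6, t7]"
proof -
  define st where "st v = [tape_at W (Suc (n + u * n + v)), t1, vec n nonsource v, vec n nonsource u,
    vec n (\<lambda>j. if j < v then dominated (Suc u) j else dominated u j) v, t5, t6, t7]" for v
  have "runs mark_dominated_row (st 0) (n * Suc 3 + 1) (st n)"
    unfolding mark_dominated_row_def
  proof (rule runs_While)
    fix v assume "v < n"
    then show "runs (Act 4 (\<lambda>s. if s ! 3 = 1 \<and> s ! 0 = 2 then 2 else s ! 4) MoveRight ;;
        mv 0 MoveRight ;; mv 2 MoveRight) (st v) 3 (st (Suc v))"
      using assms by (intro runs_loop_free)
        (auto simp: st_def W_matrix dominated_Suc intro!: vec_cong)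
  qed (auto simp: st_def)
  moreover have "st n = [tape_at W (Suc (n + u * n + n)), t1, vec n nonsource n, vec n nonsource u,
      vec n (dominated (Suc u)) n, t5, t6, t7]"
    by (auto simp: st_def intro: vec_cong)
  ultimately show ?thesis
    by (simp add: st_def mult.commute)
qed

lemma runs_mark_dominated:
  "runs mark_dominated
    [tape_at W (Suc n), t1, vec n nonsource 0, vec n nonsource 0, vec n (\<lambda>_. 1) 0, t5, t6, t7]
    (8 * n * n + 11 * n + 4)
    [tape_at W (Suc (n + n * n)), t1, vec n nonsource 0, vec n nonsource 0, vec n (dominated n) 0, t5, t6, t7]"
proof -
  define st where "st u = [tape_at W (Suc (n + u * n)), t1, vec n nonsource 0, vec n nonsource u,
    vec n (dominated u) 0, t5, t6, t7]" for u
  have "runs (While (\<lambda>s. s ! 3 \<noteq> 0) (mark_dominated_row ;; rewind 2 ;; rewind 4 ;; mv 3 MoveRight)) (st 0)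
      (n * Suc (4 * n + 1 + (2 * n + 3 + (2 * n + 3 + 1))) + 1) (st n)"
  proof (rule runs_While)
    fix u assume u: "u < n"
    have step: "runs (mv 3 MoveRight) [tape_at W (Suc (n + u * n + n)), t1, vec n nonsource 0,
        vec n nonsource u, vec n (dominated (Suc u)) 0, t5, t6, t7] 1 (st (Suc u))"
      by (intro runs_loop_free) (simp_all add: st_def algebra_simps)
    show "runs (mark_dominated_row ;; rewind 2 ;; rewind 4 ;; mv 3 MoveRight) (st u)
        (4 * n + 1 + (2 * n + 3 + (2 * n + 3 + 1))) (st (Suc u))"
      unfolding st_def[of u]
      by (rule runs_Seq[OF runs_mark_dominated_row[OF u]
            runs_Seq[OF runs_rewind_2 runs_Seq[OF runs_rewind_4 step]]]) simp_all
  qed (auto simp: st_def)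
  moreover have "runs (rewind 3) (st n) (2 * n + 3) ((st n)[3 := vec n nonsource 0])"
    unfolding st_def using runs_rewind_3[of n n nonsource] by simp
  ultimately have "runs mark_dominated (st 0)
      (n * Suc (4 * n + 1 + (2 * n + 3 + (2 * n + 3 + 1))) + 1 + (2 * n + 3))
      ((st n)[3 := vec n nonsource 0])"
    unfolding mark_dominated_def by (rule runs_Seq)
  then show ?thesis
    by (auto simp: st_def dominated_0 algebra_simps elim!: runs_mono)
qed

lemma runs_write_order:
  "runs write_order [t0, out_tape xs, vec n nonsource 0, t3, t4, t5, t6, t7] (7 * n + 6)
    [t0, out_tape (xs @ 2 # map (\<lambda>_. 2) (nonsources_below n) @ [1]), vec n nonsource 0, t3, t4, t5, t6, t7]"
proof -
  define st where "st v = [t0, out_tape (xs @ 2 # map (\<lambda>_. 2) (nonsources_below v)),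
    vec n nonsource v, t3, t4, t5, t6, t7]" for v
  have "runs (put 1 2 MoveRight) [t0, out_tape xs, vec n nonsource 0, t3, t4, t5, t6, t7] 1 (st 0)"
    by (intro runs_loop_free) (simp_all add: st_def)
  moreover have "runs (While (\<lambda>s. s ! 2 \<noteq> 0)
      (Cond (\<lambda>s. s ! 2 = 2) (put 1 2 MoveRight) skip ;; mv 2 MoveRight)) (st 0) (n * Suc 4 + 1) (st n)"
    by (rule runs_While) (auto simp: st_def intro!: runs_loop_free)
  moreover have "runs (rewind 2) (st n) (2 * n + 3) ((st n)[2 := vec n nonsource 0])"
    unfolding st_def using runs_rewind_2[of n n nonsource] by simp
  moreover have "runs (put 1 1 MoveRight) ((st n)[2 := vec n nonsource 0]) 1
      [t0, out_tape (xs @ 2 # map (\<lambda>_. 2) (nonsources_below n) @ [1]), vec n nonsource 0, t3, t4, t5, t6, t7]"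
    by (intro runs_loop_free) (simp_all add: st_def)
  ultimately show ?thesis
    unfolding write_order_def
    by - (rule runs_mono, (rule runs_Seq | assumption)+, simp)
qed

lemma runs_write_source_row:
  "runs write_source_row [t0, out_tape xs, vec n nonsource 0, t3, vec n f 0, t5, t6, t7] (8 * n + 5)
    [t0, out_tape (xs @ 1 # map f (nonsources_below n)), vec n nonsource 0, t3, vec n f n, t5, t6, t7]"
proof -
  define st where "st v = [t0, out_tape (xs @ 1 # map f (nonsources_below v)),
    vec n nonsource v, t3, vec n f v, t5, t6, t7]" for v
  have "runs (put 1 1 MoveRight) [t0, out_tape xs, vec n nonsource 0, t3, vec n f 0, t5, t6, t7] 1 (st 0)"
    by (intro runs_loop_free) (simp_all add: st_def)
  moreover have "runs (While (\<lambda>s. s ! 2 \<noteq> 0)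
      (Cond (\<lambda>s. s ! 2 = 2) (Act 1 (\<lambda>s. s ! 4) MoveRight) skip ;; mv 2 MoveRight ;; mv 4 MoveRight))
      (st 0) (n * Suc 5 + 1) (st n)"
    by (rule runs_While) (auto simp: st_def intro!: runs_loop_free)
  moreover have "runs (rewind 2) (st n) (2 * n + 3) ((st n)[2 := vec n nonsource 0])"
    unfolding st_def using runs_rewind_2[of n n nonsource] by simp
  ultimately have "runs write_source_row [t0, out_tape xs, vec n nonsource 0, t3, vec n f 0, t5, t6, t7]
      (1 + (n * Suc 5 + 1 + (2 * n + 3))) ((st n)[2 := vec n nonsource 0])"
    unfolding write_source_row_def by (intro runs_Seq)
  then show ?thesis
    by (auto simp: st_def elim!: runs_mono)
qed

abbreviation row :: "nat \<Rightarrow> nat list" where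
  "row u \<equiv> 1 # map (\<lambda>v. bit_symbol (A u v)) (nonsources_below n)"

lemma runs_write_row:
  assumes "u < n"
  shows "runs write_row
    [tape_at W (Suc (n + u * n)), out_tape xs, vec n nonsource 0, vec n nonsource u, t4, t5, t6, t7]
    (6 * n + 4)
    [tape_at W (Suc (n + u * n + n)), out_tape (xs @ (if nonsource u = 2 then row u else [])),
     vec n nonsource n, vec n nonsource u, t4, t5, t6, t7]"
proof -
  define st where "st v = [tape_at W (Suc (n + u * n + v)),
    out_tape (xs @ (if nonsource u = 2 then 1 # map (\<lambda>v. bit_symbol (A u v)) (nonsources_below v) else [])),
    vec n nonsource v, vec n nonsource u, t4, t5, t6, t7]" for v
  have "runs (Cond (\<lambda>s. s ! 3 = 2) (put 1 1 MoveRight) skip)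
      [tape_at W (Suc (n + u * n)), out_tape xs, vec n nonsource 0, vec n nonsource u, t4, t5, t6, t7]
      3 (st 0)"
    using assms by (intro runs_loop_free) (auto simp: st_def)
  moreover have "runs (While (\<lambda>s. s ! 2 \<noteq> 0)
       (Cond (\<lambda>s. s ! 2 = 2 \<and> s ! 3 = 2) (Act 1 (\<lambda>s. s ! 0) MoveRight) skip ;;
        mv 0 MoveRight ;; mv 2 MoveRight)) (st 0) (n * Suc 5 + 1) (st n)"
    using assms by (intro runs_While) (auto simp: st_def W_matrix intro!: runs_loop_free)
  ultimately have "runs write_row
      [tape_at W (Suc (n + u * n)), out_tape xs, vec n nonsource 0, vec n nonsource u, t4, t5, t6, t7]
      (3 + (n * Suc 5 + 1)) (st n)"
    unfolding write_row_def by (rule runs_Seq)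
  then show ?thesis
    by (auto simp: st_def elim!: runs_mono)
qed

lemma runs_write_rows:
  "runs write_rows
    [tape_at W (Suc n), out_tape xs, vec n nonsource 0, vec n nonsource 0, t4, t5, t6, t7]
    (8 * n * n + 9 * n + 1)
    [tape_at W (Suc (n + n * n)), out_tape (xs @ concat (map row (nonsources_below n))),
     vec n nonsource 0, vec n nonsource n, t4, t5, t6, t7]"
proof -
  define st where "st u = [tape_at W (Suc (n + u * n)),
    out_tape (xs @ concat (map row (nonsources_below u))), vec n nonsource 0, vec n nonsource u,
    t4, t5, t6, t7]" for u
  have "runs write_rows (st 0) (n * Suc (6 * n + 4 + (2 * n + 3 + 1)) + 1) (st n)"
    unfolding write_rows_def
  proof (rule runs_While)
    fix u assume u: "u < n"
    let ?ys = "xs @ concat (map row (nonsources_below u))"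
    have step: "runs (mv 3 MoveRight) [tape_at W (Suc (n + u * n + n)),
        out_tape (?ys @ (if nonsource u = 2 then row u else [])), vec n nonsource 0, vec n nonsource u,
        t4, t5, t6, t7] 1 (st (Suc u))"
      by (intro runs_loop_free) (simp_all add: st_def algebra_simps)
    show "runs (write_row ;; rewind 2 ;; mv 3 MoveRight) (st u)
        (6 * n + 4 + (2 * n + 3 + 1)) (st (Suc u))"
      unfolding st_def[of u]
      by (rule runs_Seq[OF runs_write_row[OF u] runs_Seq[OF runs_rewind_2 step]]) simp_all
  qed (auto simp: st_def)
  then show ?thesis
    by (auto simp: st_def algebra_simps elim!: runs_mono)
qed

lemma runs_write_parameter:
  "runs write_parameter [tape_at W (Suc (n + n * n)), out_tape xs, t2, t3, t4, t5, t6, t7]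
    (3 * length ks + 4)
    [tape_at W (length W), out_tape (xs @ bit_symbol neg # ks), t2, t3, t4, t5, t6, t7]"
proof -
  let ?ys = "bit_symbol neg # ks"
  define st where "st i = [tape_at W (Suc (n + n * n + i)), out_tape (xs @ take i ?ys),
    t2, t3, t4, t5, t6, t7]" for i
  have nz: "?ys ! i \<noteq> 0" if "i < length ?ys" for i
    using ks nth_mem[OF that] by auto
  have W_ys: "W ! Suc (n + n * n + i) = ?ys ! i" if "i < length ?ys" for i
    using that W_parameter by (cases i) auto
  have "runs write_parameter (st 0) (length ?ys * Suc 2 + 1) (st (length ?ys))"
    unfolding write_parameter_def
  proof (rule runs_While)
    fix i assume i: "i < length ?ys"
    then show "map scanned (st i) ! 0 \<noteq> 0"
      using nz[OF i] W_ys[OF i] by (simp add: st_def length_W)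
    show "runs (Act 1 (\<lambda>s. s ! 0) MoveRight ;; mv 0 MoveRight) (st i) 2 (st (Suc i))"
      using i W_ys[OF i] by (intro runs_loop_free)
        (simp_all add: st_def length_W take_Suc_conv_app_nth del: take_Suc_Cons)
  qed (simp add: st_def length_W)
  then show ?thesis
    by (auto simp: st_def length_W elim!: runs_mono)
qed

section \<open>Output and running time of the whole program\<close>

definition kernel_output :: "nat list" where
  "kernel_output = 2 # map (\<lambda>_. 2) (nonsources_below n) @ [1] @
     (1 # map (dominated n) (nonsources_below n)) @ concat (map row (nonsources_below n)) @ bit_symbol neg # ks"

lemma runs_write_kernel:
  obtains us where
    "runs write_kernel
      [tape_at W (length W), out_tape [], vec n nonsource 0, vec n nonsource 0, vec n (\<lambda>_. 1) 0, t5, t6, t7]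
      (4 * length W + 16 * n * n + 50 * n + 3 * length ks + 30) us"
    "us ! 1 = out_tape kernel_output"
proof -
  \<comment> \<open>Resolving the run lemmas into each other determines all intermediate tapes by
    unification.\<close>
  note run = runs_Seq[OF runs_goto_matrix runs_Seq[OF runs_mark_dominated
    runs_Seq[OF runs_goto_matrix runs_Seq[OF runs_write_order
    runs_Seq[OF runs_write_source_row runs_Seq[OF runs_write_rows runs_write_parameter]]]]]]
  show ?thesis
    by (rule that, unfold write_kernel_def, rule runs_mono, rule run)
      (simp_all add: length_W kernel_output_def)
qed

text \<open>Since \<open>decrements n\<close> exceeds the threshold of the kernel by 1, the strict
  comparison is the non-strict one with the threshold.\<close>

definition output_symbols :: "nat list" where
  "output_symbols = (if neg \<or> bits_val ks < decrements n then [1, 1] else kernel_output)"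

text \<open>The matrix is part of the input, so n * n is at most the input length. Only the repeated
  decrements contribute a product, n times the number of digits, and make the bound quadratic; 200
  is a generous common constant.\<close>

lemma time_bound:
  assumes "T \<le> 21 * (n * n) + 4 * (n * length ks) + 100 * n + 20 * length ks + 4 * length W + 100"
  shows "T \<le> 200 * (1 + length W) ^ 2"
proof -
  have le: "n * n \<le> length W" "n \<le> length W" "length ks \<le> length W"
    by (simp_all add: length_W)
  then have "n * length ks \<le> length W * length W"
    by (intro mult_le_mono)
  moreover have "200 * (1 + length W) ^ 2 = 200 + 400 * length W + 200 * (length W * length W)"
    by (simp add: power2_eq_square algebra_simps)
  ultimately show ?thesis
    using le assms by linarith
qed

lemma runs_kernelize:
  obtains us where
    "runs kernelize (tape_at W 0 # replicate 7 (tape_at [] 0)) (200 * (1 + length W) ^ 2) us"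
    "us ! 1 = out_tape output_symbols"
proof -
  let ?c = "vec n nonsource 0" and ?d = "vec n (\<lambda>_. 1) 0"
  define ts where "ts = [tape_at W (Suc (n + n * n)), out_tape [], ?c, ?c, ?d,
    tape_at [] 0, tape_at [] 0, tape_at [1] 0]"
  define ts' where "ts' = [tape_at W (length W), out_tape [], ?c, ?c, ?d,
    tape_at (fst (counter (decrements n))) 0, tape_at [snd (counter (decrements n))] 0,
    tape_at [(length (nonsources_below n) + 1) mod 3] 0]"
  have init: "tape_at W 0 # replicate 7 (tape_at [] 0) = [tape_at W 0, out_tape [], tape_at [] 0, tape_at [] 0,
      tape_at [] 0, tape_at [] 0, tape_at [] 0, tape_at [] 0]"
    by (simp add: out_tape_def numeral_eq_Suc)
  \<comment> \<open>The prefix is treated with an arbitrary continuation q, so that the branches can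
    be distinguished on the remaining program alone; \<open>load\<close> serves the same
    purpose.\<close>
  have start: "runs (prepare ;; mark_nonsources ;; q) (tape_at W 0 # replicate 7 (tape_at [] 0))
      (11 * n + 12 + (5 * n * n + 15 * n + 11 + T)) us" if "runs q ts T us" for q T us
    unfolding init
    by (rule runs_Seq[OF runs_prepare runs_Seq[OF runs_mark_nonsources that[unfolded ts_def]]])
  have sign: "map scanned ts ! 0 = bit_symbol neg"
    using W_parameter(1) by (simp add: ts_def length_W)
  have flag: "map scanned ts' ! 6 = (if decrements n \<le> bits_val ks then 0 else 2)"
    by (simp add: ts'_def underflow)
  have yes: "runs write_yes [t0, out_tape [], t2, t3, t4, t5, t6, t7] 2
      [t0, out_tape [1, 1], t2, t3, t4, t5, t6, t7]" for t0 t2 t3 t4 t5 t6 t7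
    unfolding write_yes_def by (intro runs_loop_free) simp_all
  \<comment> \<open>The budgets \<open>?K\<close> and \<open>?P\<close> follow the longest branch;
    \<open>write_yes\<close> takes 2 steps and is padded to them by
    \<open>runs_mono\<close>.\<close>
  let ?K = "4 * length W + 16 * n * n + 50 * n + 3 * length ks + 30"
  let ?P = "1 + (5 * length ks + 4 + (n * (4 * length ks + 15) + 4 * length ks + 12 + Suc ?K))"
  have load: "runs (mv 0 MoveRight ;; load_parameter ;; count_nonsources ;; q) ts
      (1 + (5 * length ks + 4 + (n * (4 * length ks + 15) + 4 * length ks + 12 + T))) us"
    if "runs q ts' T us" for q T us
  proof -
    have "runs (mv 0 MoveRight) ts 1 [tape_at W (Suc (Suc (n + n * n))), out_tape [], ?c, ?c, ?d,
        tape_at [] 0, tape_at [] 0, tape_at [1] 0]"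
      by (intro runs_loop_free) (simp_all add: ts_def)
    from runs_Seq[OF this runs_Seq[OF runs_load_parameter runs_Seq[OF runs_count_nonsources that[unfolded ts'_def]]]]
    show ?thesis .
  qed
  have "\<exists>us. runs (Cond (\<lambda>s. s ! 0 = 2) write_yes
       (mv 0 MoveRight ;; load_parameter ;; count_nonsources ;;
        Cond (\<lambda>s. s ! 6 = 2) write_yes write_kernel)) ts (Suc ?P) us \<and> us ! 1 = out_tape output_symbols"
  proof (cases neg)
    case True
    have "runs write_yes ts ?P (ts[1 := out_tape [1, 1]])"
      by (rule runs_mono[of _ _ 2]) (use yes in \<open>simp_all add: ts_def\<close>)
    moreover have "map scanned ts ! 0 = 2" "output_symbols = [1, 1]"
      unfolding output_symbols_def using True sign by simp_all
    moreover have "ts[1 := out_tape [1, 1]] ! 1 = out_tape [1, 1]"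
      by (simp add: ts_def)
    ultimately show ?thesis
      by (intro exI[of _ "ts[1 := out_tape [1, 1]]"] conjI runs_Cond) simp_all
  next
    case False
    have "\<exists>us. runs (Cond (\<lambda>s. s ! 6 = 2) write_yes write_kernel) ts' (Suc ?K) us \<and> us ! 1 = out_tape output_symbols"
    proof (cases "decrements n \<le> bits_val ks")
      case True
      obtain us where "runs write_kernel ts' ?K us" "us ! 1 = out_tape kernel_output"
        unfolding ts'_def by (rule runs_write_kernel)
      moreover have "output_symbols = kernel_output" "map scanned ts' ! 6 = 0"
        unfolding output_symbols_def using True False flag by simp_all
      ultimately show ?thesis
        by (intro exI[of _ us] conjI runs_Cond) simp_all
    next
      case False
      have "runs write_yes ts' ?K (ts'[1 := out_tape [1, 1]])"
        by (rule runs_mono[of _ _ 2]) (use yes in \<open>simp_all add: ts'_def\<close>)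
      moreover have "map scanned ts' ! 6 = 2" "output_symbols = [1, 1]"
        unfolding output_symbols_def using False flag by simp_all
      moreover have "ts'[1 := out_tape [1, 1]] ! 1 = out_tape [1, 1]"
        by (simp add: ts'_def)
      ultimately show ?thesis
        by (intro exI[of _ "ts'[1 := out_tape [1, 1]]"] conjI runs_Cond) simp_all
    qed
    then obtain us where us: "runs (Cond (\<lambda>s. s ! 6 = 2) write_yes write_kernel) ts' (Suc ?K) us"
        "us ! 1 = out_tape output_symbols"
      by blast
    moreover have "map scanned ts ! 0 \<noteq> 2"
      using False sign by simp
    ultimately show ?thesis
      using load[OF us(1)] by (intro exI[of _ us] conjI runs_Cond) simp_all
  qed
  then obtain us where us: "runs (Cond (\<lambda>s. s ! 0 = 2) write_yes
       (mv 0 MoveRight ;; load_parameter ;; count_nonsources ;;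
        Cond (\<lambda>s. s ! 6 = 2) write_yes write_kernel)) ts (Suc ?P) us" "us ! 1 = out_tape output_symbols"
    by blast
  have "runs kernelize (tape_at W 0 # replicate 7 (tape_at [] 0)) (200 * (1 + length W) ^ 2) us"
    unfolding kernelize_def using start[OF us(1)]
    by (rule runs_mono) (rule time_bound, simp add: algebra_simps)
  then show ?thesis
    using that us(2) by blast
qed

end


section \<open>Correctness on encoded instances\<close>

lemma product_conv_concat: "List.product xs ys = concat (map (\<lambda>x. map (Pair x) ys) xs)"
  by (induction xs) auto

text \<open>The row and the column of vertex 0 are split off, and every other index is replaced by
  the entry of \<open>nonsources G\<close> that it numbers. This brings the code into the shape of
  \<open>kernel_output\<close> without the parameter.\<close>

lemma map_digraph_bits_merge_sources:
  fixes G :: "nat pair_pre_digraph"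
  defines "xs \<equiv> nonsources G"
  shows "map bit_symbol (digraph_bits (merge_sources G)) =
    2 # map (\<lambda>_. 2) xs @ [1] @ (1 # map (\<lambda>v. bit_symbol (source_dominated G v)) xs) @
    concat (map (\<lambda>u. 1 # map (\<lambda>v. bit_symbol ((u, v) \<in> parcs G)) xs) xs)"
proof -
  let ?H = "merge_sources G" and ?m = "length xs"
  have upt: "[0..<Suc ?m] = 0 # map Suc [0..<?m]"
    by (simp add: upt_conv_Cons map_Suc_upt del: upt_Suc)
  have nth: "map f xs = map (\<lambda>i. f (xs ! i)) [0..<?m]" for f :: "nat \<Rightarrow> 'b"
    by (rule nth_equalityI) simp_all
  have row: "map (bit_symbol \<circ> (\<lambda>e. e \<in> parcs ?H)) (map (Pair i) [0..<Suc ?m]) =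
      1 # map (\<lambda>j. bit_symbol ((i, Suc j) \<in> parcs ?H)) [0..<?m]" for i
    unfolding upt by (simp add: bit_symbol_def)
  have row_0: "map (\<lambda>j. bit_symbol ((0, Suc j) \<in> parcs ?H)) [0..<?m] =
      map (\<lambda>v. bit_symbol (source_dominated G v)) xs"
    unfolding nth by (simp add: xs_def)
  have row_Suc: "map (\<lambda>j. bit_symbol ((Suc i, Suc j) \<in> parcs ?H)) [0..<?m] =
      map (\<lambda>v. bit_symbol ((xs ! i, v) \<in> parcs G)) xs" if "i < ?m" for i
    unfolding nth using that by (simp add: xs_def)
  have rows: "map (\<lambda>i. 1 # map (\<lambda>j. bit_symbol ((Suc i, Suc j) \<in> parcs ?H)) [0..<?m]) [0..<?m] =
      map (\<lambda>i. 1 # map (\<lambda>v. bit_symbol ((xs ! i, v) \<in> parcs G)) xs) [0..<?m]"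
    by (rule map_cong) (simp_all add: row_Suc del: parcs_merge_sources_iff)
  have "map bit_symbol (digraph_bits ?H) = replicate (Suc ?m) 2 @ [1] @
      concat (map (\<lambda>i. map (bit_symbol \<circ> (\<lambda>e. e \<in> parcs ?H)) (map (Pair i) [0..<Suc ?m])) [0..<Suc ?m])"
    by (simp add: digraph_bits_def pverts_merge_sources Let_def product_conv_concat map_concat xs_def
        bit_symbol_def comp_def del: upt_Suc)
  also have "concat (map (\<lambda>i. map (bit_symbol \<circ> (\<lambda>e. e \<in> parcs ?H)) (map (Pair i) [0..<Suc ?m])) [0..<Suc ?m]) =
      (1 # map (\<lambda>v. bit_symbol (source_dominated G v)) xs) @
      concat (map (\<lambda>i. 1 # map (\<lambda>v. bit_symbol ((xs ! i, v) \<in> parcs G)) xs) [0..<?m])"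
    unfolding row unfolding upt by (simp add: row_0 rows[unfolded One_nat_def] comp_def del: parcs_merge_sources_iff)
  also have "map (\<lambda>i. 1 # map (\<lambda>v. bit_symbol ((xs ! i, v) \<in> parcs G)) xs) [0..<?m] =
      map (\<lambda>u. 1 # map (\<lambda>v. bit_symbol ((u, v) \<in> parcs G)) xs) xs"
    by (rule nth[of "\<lambda>u. 1 # map (\<lambda>v. bit_symbol ((u, v) \<in> parcs G)) xs", symmetric])
  finally show ?thesis
    by (simp add: map_replicate_const)
qed

lemma map_int_bits: "map bit_symbol (int_bits k) = bit_symbol (k < 0) # map bit_symbol (nat_bits (nat \<bar>k\<bar>))"
  by (simp add: int_bits_def)

context
  fixes G :: "nat pair_pre_digraph" and k :: int
  assumes numbered: "numbered_digraph G"
begin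

interpretation machine: matrix_input "card (pverts G)" "\<lambda>u v. (u, v) \<in> parcs G" "k < 0"
  "map bit_symbol (nat_bits (nat \<bar>k\<bar>))"
  by unfold_locales (auto simp: bit_symbol_def)

lemma nonsource_iff: "machine.nonsource v = 2 \<longleftrightarrow> (\<exists>u. (u, v) \<in> parcs G)"
  using parcs_bounded[OF numbered] by (auto simp: machine.indeg_def)

lemma nonsources_below_eq: "machine.nonsources_below (card (pverts G)) = nonsources G"
  by (simp add: nonsources_def nonsource_iff)

lemma dominated_eq: "machine.dominated (card (pverts G)) v = bit_symbol (source_dominated G v)"
proof -
  have "machine.nonsource u = 1 \<longleftrightarrow> (\<forall>t. (t, u) \<notin> parcs G)" for u
    using nonsource_iff[of u] by (auto simp: machine.indeg_def)
  then show ?thesis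
    using parcs_bounded[OF numbered]
    by (auto simp: machine.dominated_def source_dominated_def intro!: arg_cong[where f = bit_symbol])
qed

lemma W_eq: "machine.W = map bit_symbol (instance_bits (G, k))"
  by (simp add: machine.W_def instance_bits_def digraph_bits_def map_int_bits Let_def bit_symbol_def
      case_prod_unfold comp_def)

text \<open>The sign test and the underflow test together amount to the single comparison in
  \<open>kernel\<close>: a negative k is below the nonnegative threshold, and for the others the
  absolute value is k itself.\<close>

lemma output_symbols_eq: "machine.output_symbols = map bit_symbol (instance_bits (kernel (G, k)))"
proof (cases "k \<le> int ((length (nonsources G) + 1) div 3)")
  case True
  then have "k < 0 \<or> nat \<bar>k\<bar> < machine.decrements (card (pverts G))"
    unfolding machine.decrements_def nonsources_below_eq by linarith
  then have "machine.output_symbols = [1, 1]"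
    unfolding machine.output_symbols_def bits_val_nat_bits by (rule if_P)
  moreover have "nat_bits 0 = []"
    by (subst nat_bits.simps) simp
  ultimately show ?thesis
    using True by (simp add: instance_bits_def digraph_bits_def int_bits_def bit_symbol_def)
next
  case False
  then have "\<not> (k < 0 \<or> nat \<bar>k\<bar> < machine.decrements (card (pverts G)))"
    unfolding machine.decrements_def nonsources_below_eq by linarith
  then have "machine.output_symbols = machine.kernel_output"
    unfolding machine.output_symbols_def bits_val_nat_bits by (rule if_not_P)
  then show ?thesis
    using False unfolding machine.kernel_output_def nonsources_below_eq
    by (simp add: dominated_eq instance_bits_def map_digraph_bits_merge_sources map_int_bits)
qed

lemma tm_halts_with_kernel:
  obtains t where "t \<le> 200 * (1 + length (instance_bits (G, k))) ^ 2"
    "tm_halts_with (prog_tm 8 3 kernelize) (instance_bits (G, k)) t (instance_bits (kernel (G, k)))"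
proof -
  let ?w = "instance_bits (G, k)"
  obtain us where "runs kernelize (tape_at machine.W 0 # replicate 7 (tape_at [] 0))
      (200 * (1 + length machine.W) ^ 2) us" "us ! 1 = out_tape machine.output_symbols"
    by (rule machine.runs_kernelize)
  moreover have "snd (tm_init (prog_tm 8 3 kernelize) ?w) = tape_at machine.W 0 # replicate 7 (tape_at [] 0)"
    by (simp add: tm_init_def prog_tm_def W_eq tape_at_bits) (simp add: tape_at_def fun_eq_iff)
  moreover have "fst (out_tape machine.output_symbols) = bits_on_tape (instance_bits (kernel (G, k)))"
    by (simp add: out_tape_def output_symbols_eq fst_tape_at del: kernel.simps)
  ultimately show ?thesis
    using that tm_halts_with_prog_tm[of kernelize 8 3 ?w] by (auto simp: runs_def W_eq)
qed

end

theorem theorem6: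
  shows "\<exists>(F :: nat pair_pre_digraph \<times> int \<Rightarrow> nat pair_pre_digraph \<times> int) (f :: int \<Rightarrow> int).
    polytime_computable_on {(G, k). numbered_digraph G} instance_bits F \<and>
    (\<forall>G k G' k'. numbered_digraph G \<and> F (G, k) = (G', k') \<longrightarrow>
       numbered_digraph G' \<and>
       (directed_nonblocker G' k' \<longleftrightarrow> directed_nonblocker G k) \<and>
       \<bar>k'\<bar> \<le> f k \<and>
       (k \<ge> 1 \<longrightarrow> int (card (pverts G')) \<le> 3 * k - 1))"
proof (intro exI[of _ kernel] exI[of _ abs] conjI allI impI)
  show "polytime_computable_on {(G, k). numbered_digraph G} instance_bits kernel"
    unfolding polytime_computable_on_def
  \<comment> \<open>Eight tapes and the symbols 0, 1, 2; the polynomial is 200 * (1 + x)^2 from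
    \<open>time_bound\<close>.\<close>
  proof (intro exI[of _ "prog_tm 8 3 kernelize"] exI[of _ "[:200:] * [:1, 1:] ^ 2"] conjI ballI)
    show "wf_tm (prog_tm 8 3 kernelize)"
      using wf_prog_kernelize by (rule wf_tm_prog_tm) simp_all
    fix x :: "nat pair_pre_digraph \<times> int"
    assume "x \<in> {(G, k). numbered_digraph G}"
    then obtain G k where x: "x = (G, k)" "numbered_digraph G"
      by auto
    have "poly ([:200:] * [:1, 1:] ^ 2) l = 200 * (1 + l) ^ 2" for l :: nat
      by (simp add: poly_power)
    then show "\<exists>t\<le>poly ([:200:] * [:1, 1:] ^ 2) (length (instance_bits x)).
        tm_halts_with (prog_tm 8 3 kernelize) (instance_bits x) t (instance_bits (kernel x))"
      using tm_halts_with_kernel[OF x(2), of k] unfolding x(1) by metis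
  qed
\<comment> \<open>\<open>abs\<close> bounds the new parameter because that parameter is either k or
  0.\<close>
qed (use kernel_correct in blast)+

end
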